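(* Let $K/\mathbb{Q}$ be a number field of degree $n$. Let $\mathfrak{p}$ be a nonzero prime ideal of $\mathcal{O}_K$ lying over the rational prime $p$. Let $T \neq \{\mathfrak{p}\}$ be a nonempty finite set of nonzero prime ideals of $\mathcal{O}_K$. Then the arithmetic subderivative $D_{K,T}: K \to K$ is $\mathfrak{p}$-adically discontinuous at every nonzero $x \in K$.
   Context: For a nonzero prime ideal $\mathfrak{q}$ of the ring of integers of a number field lying over the rational prime $q$, $\nu_{\mathfrak{q}}$ denotes the associated discrete valuation normalized to extend $\nu_q$, and for a finite Galois extension $L/\mathbb{Q}$, $g(q,L)$ is the number of prime ideals of $\mathcal{O}_L$ over $q$. For $L/\mathbb{Q}$ finite Galois and a set $T'$ of nonzero prime ideals of $\mathcal{O}_L$, $D_{L,T'}(0)=0$ and $D_{L,T'}(x) := x\sum_{\mathfrak{Q}\in T'} \frac{\nu_{\mathfrak{Q}}(x)}{q\,g(q,L)}$ for $x\ne 0$ ($q$ the prime below $\mathfrak{Q}$). For a number field $K$ and a set $T$ of prime ideals of $\mathcal{O}_K$, choose a finite extension $L/K$ with $L/\mathbb{Q}$ Galois, let $T_{L/K}$ be the prime ideals of $\mathcal{O}_L$ lying over elements of $T$, and define $D_{K,T}(x) := D_{L,T_{L/K}}(x)$ (independent of $L$). The $\mathfrak{p}$-adic topology is given by $|x|_{\nu_{\mathfrak{p}}} = c^{\nu_{\mathfrak{p}}(x)}$, $0<c<1$ fixed. *)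

theory Defs
  imports
    "HOL-Analysis.Analysis"
    "HOL-Algebra.Algebraic_Closure_Type"
    "HOL-Algebra.Ideal_Product"
begin

text \<open>
  A number field is a subfield \<open>K\<close> of an arbitrary field of characteristic 0 (given as a type)
  that has finite dimension over the subfield \<open>\<rat>\<close>; \<open>K = UNIV\<close> is allowed.
\<close>

definition number_field :: "'a::field_char_0 set \<Rightarrow> bool" where
  "number_field K \<longleftrightarrow>
     subfield K ring_of_type_algebra \<and> ring.finite_dimension ring_of_type_algebra \<rat> K"

definition has_degree :: "'a::field_char_0 set \<Rightarrow> nat \<Rightarrow> bool" where
  "has_degree K n \<longleftrightarrow> ring.dimension ring_of_type_algebra n \<rat> K"

definition ring_of_integers :: "'a::field_char_0 set \<Rightarrow> 'a ring" where
  "ring_of_integers K = ring_of_type_algebra\<lparr>carrier := {x \<in> K. algebraic_int x}\<rparr>"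

definition nonzero_primes :: "'a::field_char_0 set \<Rightarrow> 'a set set" where
  "nonzero_primes K = {P. primeideal P (ring_of_integers K) \<and> P \<noteq> {0}}"

definition lies_over_rational :: "'a::field_char_0 set \<Rightarrow> nat \<Rightarrow> bool" where
  "lies_over_rational P q \<longleftrightarrow> P \<inter> \<int> = range (\<lambda>k. of_int (int q * k))"

definition prime_below :: "'a::field_char_0 set \<Rightarrow> nat" where
  "prime_below P = (THE q. Factorial_Ring.prime q \<and> lies_over_rational P q)"

definition num_primes_over :: "nat \<Rightarrow> 'a::field_char_0 set \<Rightarrow> nat" where
  "num_primes_over q L = card {Q \<in> nonzero_primes L. lies_over_rational Q q}"

definition ideal_mult :: "'a::field_char_0 set \<Rightarrow> 'a set \<Rightarrow> 'a \<Rightarrow> nat" where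
  "ideal_mult K P a = (GREATEST n. a \<in> P [^]\<^bsub>ideals_set (ring_of_integers K)\<^esub> n)"

text \<open>
  The \<open>\<int>\<close>-valued order at \<open>P\<close>, extended from nonzero integers to nonzero \<open>x = a / b \<in> K\<close>.
  Like \<open>prime_val\<close> below, it is meaningful for \<open>x \<noteq> 0\<close> only.
\<close>

definition prime_ord :: "'a::field_char_0 set \<Rightarrow> 'a set \<Rightarrow> 'a \<Rightarrow> int" where
  "prime_ord K P x = (THE k. \<exists>a \<in> carrier (ring_of_integers K) - {0}.
     \<exists>b \<in> carrier (ring_of_integers K) - {0}.
       x = a / b \<and> k = int (ideal_mult K P a) - int (ideal_mult K P b))"

text \<open>
  Division by the ramification index, which is the order of \<open>q\<close> at \<open>P\<close>, gives the normalization
  that extends the \<open>q\<close>-adic valuation of \<open>\<rat>\<close>.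
\<close>

definition prime_val :: "'a::field_char_0 set \<Rightarrow> 'a set \<Rightarrow> 'a \<Rightarrow> rat" where
  "prime_val K P x = of_int (prime_ord K P x) / of_int (prime_ord K P (of_nat (prime_below P)))"

definition padic_abs :: "real \<Rightarrow> 'a::field_char_0 set \<Rightarrow> 'a set \<Rightarrow> 'a \<Rightarrow> real" where
  "padic_abs c K P x = (if x = 0 then 0 else c powr of_rat (prime_val K P x))"

definition padic_topology :: "real \<Rightarrow> 'a::field_char_0 set \<Rightarrow> 'a set \<Rightarrow> 'a topology" where
  "padic_topology c K P = Metric_space.mtopology K (\<lambda>x y. padic_abs c K P (x - y))"

text \<open>\<open>L/\<rat>\<close> is Galois if it is finite and \<open>\<rat>\<close> is the fixed field of the automorphisms of \<open>L\<close>.\<close>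

definition galois_over_rat :: "'a::field_char_0 set \<Rightarrow> bool" where
  "galois_over_rat L \<longleftrightarrow> number_field L \<and>
     {x \<in> L. \<forall>\<sigma> \<in> ring_iso (ring_of_type_algebra\<lparr>carrier := L\<rparr>)
                           (ring_of_type_algebra\<lparr>carrier := L\<rparr>). \<sigma> x = x} = \<rat>"

text \<open>
  For infinite \<open>T\<close> the sum is the one over the finitely many \<open>Q \<in> T\<close> at which \<open>x\<close> has nonzero
  valuation; the restriction of the index set is needed because \<open>sum\<close> is 0 on infinite sets.
\<close>

definition galois_subderiv :: "'a::field_char_0 set \<Rightarrow> 'a set set \<Rightarrow> 'a \<Rightarrow> 'a" where
  "galois_subderiv L T x =
     (if x = 0 then 0
      else x * of_rat (\<Sum>Q \<in> {Q \<in> T. prime_val L Q x \<noteq> 0}.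
             prime_val L Q x / (of_nat (prime_below Q) * of_nat (num_primes_over (prime_below Q) L))))"

text \<open>
  The extension \<open>L/K\<close> is chosen inside the algebraic closure of the ambient field, into which
  \<open>K\<close> is embedded by \<open>to_ac\<close>; every number field has such an extension there.
\<close>

definition galois_extension :: "'a::field_char_0 set \<Rightarrow> 'a alg_closure set" where
  "galois_extension K = (SOME L. galois_over_rat L \<and> to_ac ` K \<subseteq> L)"

definition primes_above :: "'a::field_char_0 set \<Rightarrow> 'a set set \<Rightarrow> 'a alg_closure set \<Rightarrow>
    'a alg_closure set set" where
  "primes_above K T L =
     {Q \<in> nonzero_primes L. to_ac -` Q \<inter> carrier (ring_of_integers K) \<in> T}"

definition arith_subderiv :: "'a::field_char_0 set \<Rightarrow> 'a set set \<Rightarrow> 'a \<Rightarrow> 'a" where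
  "arith_subderiv K T x =
     of_ac (galois_subderiv (galois_extension K) (primes_above K T (galois_extension K)) (to_ac x))"

end

theory Submission
  imports Defs "Jordan_Normal_Form.Char_Poly"
begin

text \<open>
  On \<open>K - {0}\<close> one has \<open>D x = x * l x\<close> with a logarithmic derivative \<open>l\<close> that is additive on products
  and takes rational values. Choose \<open>Q \<in> T\<close> different from \<open>P\<close>. There are integers \<open>u\<close> of \<open>K\<close>
  arbitrarily close to 1 at \<open>P\<close> whose logarithmic derivative is a fixed \<open>r > 0\<close>, because only the
  valuations above \<open>Q\<close> contribute to it and these can be prescribed independently of the behaviour at
  \<open>P\<close>. Then \<open>D (x u) - D x = x ((u - 1) l x + u r)\<close> has the absolute value of \<open>x r\<close> as soon as \<open>u\<close> is
  close enough to 1.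

  The valuations are well defined since the ring of integers is locally principal, which rests on two
  facts: \<open>n + 1\<close> elements of a number field of degree \<open>n\<close> satisfy an integral linear relation with
  coefficients not all divisible
    by \<open>q\<close>, whence \<open>OK / q OK\<close> is finite; and \<open>g P \<subseteq> P\<close> forces \<open>g\<close> to be
  integral, by the pigeonhole principle for the sequence \<open>g^i q\<close> modulo \<open>q\<close>.
\<close>

section \<open>Algebraic integers form a ring\<close>

text \<open>The subderivative is computed in an extension \<open>L\<close> taken by choice, so
  nothing can be said about it before a Galois extension is known to exist; the splitting-field part
  serves this purpose. What passes from \<open>K\<close> to \<open>L\<close> is membership in
  contracted primes: an integer of \<open>K\<close> outside the contraction of a prime of
  \<open>L\<close> has value 0 there, one inside has positive value if nonzero. This is why
  \<open>r\<close> arises as the logarithmic derivative of an integral \<open>w\<close>: all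
  summands are nonnegative, so they cannot cancel, and one prime above \<open>Q\<close> makes the
  sum positive.

  Orders are given by a greatest exponent \<open>n\<close> with \<open>a \<in> P^n\<close> and by a
  unique description through fractions, so finiteness and additivity of the exponent must precede
  every use. Both are read off in the localization at \<open>P\<close>, which is never formed as a
  ring: a factor outside \<open>P\<close> takes the place of a unit. Finiteness comes down to the
  exponent of the rational prime \<open>q\<close>, because each nonzero integer of \<open>K\<close>
  divides a nonzero rational integer.\<close>

interpretation int_module: Modules.module "\<lambda>(k::int) (x::'a::field_char_0). of_int k * x"
  by unfold_locales (auto simp: algebra_simps)

text \<open>The determinant trick: \<open>x\<close> is an eigenvalue of an integer matrix, hence a
  root of its characteristic polynomial, which is monic with integer coefficients.\<close>

lemma algebraic_int_if_int_matrix_eigenvalue: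
  fixes v :: "nat \<Rightarrow> 'a::field_char_0" and c :: "nat \<Rightarrow> nat \<Rightarrow> int"
  assumes eq: "\<And>i. i < n \<Longrightarrow> x * v i = (\<Sum>j<n. of_int (c i j) * v j)"
    and nz: "i0 < n" "v i0 \<noteq> 0"
  shows "algebraic_int x"
proof -
  define A where "A = mat n n (\<lambda>(i, j). c i j)"
  have A: "A \<in> carrier_mat n n" by (simp add: A_def)
  define B :: "'a mat" where "B = map_mat of_int A"
  have B: "B \<in> carrier_mat n n" by (simp add: A B_def)
  have "eigenvector B (vec n v) x"
    unfolding eigenvector_def
  proof (intro conjI)
    show "vec n v \<in> carrier_vec (dim_row B)" using B by simp
    show "vec n v \<noteq> 0\<^sub>v (dim_row B)"
    proof
      assume "vec n v = 0\<^sub>v (dim_row B)"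
      hence "vec n v $ i0 = 0" using nz B by simp
      thus False using nz by simp
    qed
    show "B *\<^sub>v vec n v = x \<cdot>\<^sub>v vec n v"
    proof (rule eq_vecI)
      fix i assume "i < dim_vec (x \<cdot>\<^sub>v vec n v)"
      hence i: "i < n" by simp
      have "(B *\<^sub>v vec n v) $ i = (\<Sum>j<n. of_int (c i j) * v j)"
        using i B by (auto simp: scalar_prod_def B_def A_def lessThan_atLeast0 intro!: sum.cong)
      thus "(B *\<^sub>v vec n v) $ i = (x \<cdot>\<^sub>v vec n v) $ i" using eq[OF i] i by simp
    qed (use B in simp)
  qed
  hence "eigenvalue B x" unfolding eigenvalue_def by blast
  hence "poly (char_poly B) x = 0" using eigenvalue_root_char_poly[OF B] by simp
  moreover have "char_poly B = map_poly of_int (char_poly A)"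
    unfolding B_def by (rule of_int_hom.char_poly_hom[OF A])
  moreover have "Polynomial.lead_coeff (char_poly A) = 1" using degree_monic_char_poly[OF A] by simp
  ultimately show ?thesis unfolding algebraic_int_altdef_ipoly by metis
qed

text \<open>Choosing integer coordinates of each \<open>x * b\<close> turns multiplication by
  \<open>x\<close> into an integer matrix; the nonzero \<open>b0\<close> ensures that the vector of
  generators is an eigenvector.\<close>

lemma algebraic_int_if_stabilizes_span:
  fixes B :: "'a::field_char_0 set"
  assumes B: "finite B" and b0: "b0 \<in> B" "b0 \<noteq> 0"
    and st: "\<And>b. b \<in> B \<Longrightarrow> x * b \<in> int_module.span B"
  shows "algebraic_int x"
proof -
  obtain h where h: "bij_betw h {0..<card B} B" using ex_bij_betw_nat_finite[OF B] by blast
  have "\<forall>b\<in>B. \<exists>u. x * b = (\<Sum>v\<in>B. of_int (u v) * v)"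
    using st int_module.span_finite[OF B] by fastforce
  then obtain u
    where u: "\<And>b. b \<in> B \<Longrightarrow> x * b = (\<Sum>v\<in>B. of_int (u b v) * v)"
      by metis
  obtain i0 where i0: "i0 < card B" "h i0 = b0"
    using b0 h by (metis atLeastLessThan_iff bij_betw_iff_bijections)
  show ?thesis
  proof (rule algebraic_int_if_int_matrix_eigenvalue[where v = h and n = "card B" and ?i0.0 = i0 and c = "\<lambda>i j. u (h i) (h j)"])
    fix i assume "i < card B"
    hence "h i \<in> B" using h by (auto simp: bij_betw_def)
    hence "x * h i = (\<Sum>v\<in>B. of_int (u (h i) v) * v)" by (rule u)
    also have "\<dots> = (\<Sum>j<card B. of_int (u (h i) (h j)) * h j)"
      using sum.reindex_bij_betw[OF h, of "\<lambda>v. of_int (u (h i) v) * v"]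
        by (simp add: lessThan_atLeast0)
    finally show "x * h i = (\<Sum>j<card B. of_int (u (h i) (h j)) * h j)" .
  qed (use i0 b0 in auto)
qed

lemma algebraic_int_power_expansion:
  assumes "algebraic_int (x::'a::field_char_0)"
  obtains m c where "0 < m" "x ^ m = (\<Sum>i<m. of_int (c i) * x ^ i)"
proof -
  from assms obtain p :: "int poly"
    where p: "poly (map_poly of_int p) x = 0" "Polynomial.lead_coeff p = 1"
    unfolding algebraic_int_altdef_ipoly by blast
  define m where "m = Polynomial.degree p"
  have m0: "m \<noteq> 0"
  proof
    assume "m = 0"
    hence "p = 1" using p(2) m_def by (metis degree_0_id one_poly_eq_simps(1) pCons_one)
    thus False using p by simp
  qed
  have expand: "x ^ m = (\<Sum>i<m. of_int (- Polynomial.coeff p i) * x ^ i)"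
  proof -
    have "(\<Sum>i\<le>m. of_int (Polynomial.coeff p i) * x ^ i) = 0"
      using p(1) unfolding m_def by (simp add: poly_altdef coeff_map_poly)
    hence "(\<Sum>i<m. of_int (Polynomial.coeff p i) * x ^ i) + x ^ m = 0"
      using p(2) by (simp add: lessThan_Suc_atMost[symmetric] m_def)
    thus ?thesis by (simp add: sum_negf eq_neg_iff_add_eq_0 add.commute[of "x ^ m"])
  qed
  show ?thesis by (rule that[OF _ expand]) (use m0 in simp)
qed

lemma int_span_mult_closed:
  fixes B :: "'a::field_char_0 set"
  assumes st: "\<And>b. b \<in> B \<Longrightarrow> x * b \<in> int_module.span B" and s: "s \<in> int_module.span B"
  shows "x * s \<in> int_module.span B"
  using s
proof (induction rule: int_module.span_induct_alt)
  case base
  show ?case by (simp add: int_module.span_zero)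
next
  case (step c b y)
  have "x * (of_int c * b + y) = of_int c * (x * b) + x * y" by (simp add: algebra_simps)
  thus ?case using int_module.span_add[OF int_module.span_scale[OF st[OF step(1)], of c] step(2)] by simp
qed

text \<open>The monomials \<open>x^i y^j\<close> with \<open>i < m\<close> and \<open>j < n\<close>
  span a module stable under \<open>x\<close> and \<open>y\<close>, since the top powers
  \<open>x^m\<close> and \<open>y^n\<close> re-expand into lower ones. It is then stable under sum
  and product as well.\<close>

lemma algebraic_int_add_mult:
  assumes "algebraic_int (x::'a::field_char_0)" "algebraic_int y"
  shows "algebraic_int (x + y)" "algebraic_int (x * y)"
proof -
  obtain m c where m: "0 < m" "x ^ m = (\<Sum>i<m. of_int (c i) * x ^ i)"
    using algebraic_int_power_expansion[OF assms(1)] .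
  obtain n d where n: "0 < n" "y ^ n = (\<Sum>i<n. of_int (d i) * y ^ i)"
    using algebraic_int_power_expansion[OF assms(2)] .
  define B where "B = (\<lambda>(i, j). x ^ i * y ^ j) ` ({..<m} \<times> {..<n})"
  have B: "finite B" by (simp add: B_def)
  have mem: "x ^ i * y ^ j \<in> B" if "i < m" "j < n" for i j
    using that by (auto simp: B_def)
  have stx: "x * b \<in> int_module.span B" if "b \<in> B" for b
  proof -
    from that obtain i j where ij: "i < m" "j < n" "b = x ^ i * y ^ j" by (auto simp: B_def)
    show ?thesis
    proof (cases "Suc i < m")
      case True
      have "x * b = x ^ Suc i * y ^ j" by (simp add: ij)
      also have "\<dots> \<in> int_module.span B"
        by (rule int_module.span_base[OF mem[OF True ij(2)]])
      finally show ?thesis .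
    next
      case False
      hence "Suc i = m" using ij by simp
      hence "x * b = x ^ m * y ^ j" by (auto simp: ij)
      also have "\<dots> = (\<Sum>i<m. of_int (c i) * (x ^ i * y ^ j))"
        unfolding m(2) by (simp add: sum_distrib_right mult.assoc)
      also have "\<dots> \<in> int_module.span B"
        using mem ij(2)
          by (intro int_module.span_sum int_module.span_scale int_module.span_base) auto
      finally show ?thesis .
    qed
  qed
  have sty: "y * b \<in> int_module.span B" if "b \<in> B" for b
  proof -
    from that obtain i j where ij: "i < m" "j < n" "b = x ^ i * y ^ j" by (auto simp: B_def)
    show ?thesis
    proof (cases "Suc j < n")
      case True
      have "y * b = x ^ i * y ^ Suc j" by (simp add: ij)
      also have "\<dots> \<in> int_module.span B"
        by (rule int_module.span_base[OF mem[OF ij(1) True]])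
      finally show ?thesis .
    next
      case False
      hence "Suc j = n" using ij by simp
      hence "y * b = x ^ i * y ^ n" by (auto simp: ij)
      also have "\<dots> = (\<Sum>j<n. of_int (d j) * (x ^ i * y ^ j))"
        unfolding n(2) by (simp add: sum_distrib_left mult_ac)
      also have "\<dots> \<in> int_module.span B"
        using mem ij(1)
          by (intro int_module.span_sum int_module.span_scale int_module.span_base) auto
      finally show ?thesis .
    qed
  qed
  have one: "1 \<in> B" using mem[OF m(1) n(1)] by simp
  show "algebraic_int (x + y)"
  proof (rule algebraic_int_if_stabilizes_span[OF B one])
    fix b assume "b \<in> B"
    thus "(x + y) * b \<in> int_module.span B"
      using int_module.span_add[OF stx sty] by (simp add: algebra_simps)
  qed simp
  show "algebraic_int (x * y)"
  proof (rule algebraic_int_if_stabilizes_span[OF B one])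
    fix b assume "b \<in> B"
    thus "(x * y) * b \<in> int_module.span B"
      using int_span_mult_closed[OF stx sty] by (simp add: mult.assoc)
  qed simp
qed

section \<open>Subfields and integral linear relations\<close>

lemma ring_of_type_algebra_simps [simp]:
  "carrier ring_of_type_algebra = UNIV"
  "x \<otimes>\<^bsub>ring_of_type_algebra\<^esub> y = x * y"
  "x \<oplus>\<^bsub>ring_of_type_algebra\<^esub> y = x + y"
  "\<one>\<^bsub>ring_of_type_algebra\<^esub> = 1"
  "\<zero>\<^bsub>ring_of_type_algebra\<^esub> = 0"
  by (simp_all add: ring_of_type_algebra_def)

interpretation type_ring: domain "ring_of_type_algebra :: 'a::field ring"
  using field_from_type_algebra field.axioms(1) by blast

lemma type_ring_a_inv [simp]: "\<ominus>\<^bsub>ring_of_type_algebra\<^esub> x = - (x::'a::field)"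
  by (rule type_ring.minus_equality) simp_all

lemma type_ring_m_inv [simp]:
  "x \<noteq> 0 \<Longrightarrow> inv\<^bsub>ring_of_type_algebra\<^esub> x = inverse (x::'a::field)"
  by (rule type_ring.inv_char) simp_all

lemma subring_type_iff:
  "subring M (ring_of_type_algebra :: 'a::field ring) \<longleftrightarrow>
     1 \<in> M \<and> (\<forall>x\<in>M. - x \<in> M) \<and> (\<forall>x\<in>M. \<forall>y\<in>M. x + y \<in> M) \<and> (\<forall>x\<in>M. \<forall>y\<in>M. x * y \<in> M)"
proof
  assume "subring M (ring_of_type_algebra :: 'a ring)"
  from subringE[OF this] show "1 \<in> M \<and> (\<forall>x\<in>M. - x \<in> M) \<and> (\<forall>x\<in>M. \<forall>y\<in>M. x + y \<in> M) \<and> (\<forall>x\<in>M. \<forall>y\<in>M. x * y \<in> M)"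
    by simp
qed (auto intro: type_ring.subringI)

lemma subfield_type_iff:
  "subfield M (ring_of_type_algebra :: 'a::field ring) \<longleftrightarrow>
     subring M ring_of_type_algebra \<and> (\<forall>x\<in>M. inverse x \<in> M)"
proof safe
  assume M: "subfield M (ring_of_type_algebra :: 'a ring)"
  show "subring M ring_of_type_algebra" using subfieldE(1)[OF M] .
  fix x assume "x \<in> M"
  thus "inverse x \<in> M"
    using type_ring.subfield_m_inv(1)[OF M, of x] by (cases "x = 0") auto
next
  assume M: "subring M ring_of_type_algebra" "\<forall>x\<in>M. inverse x \<in> M"
  show "subfield M (ring_of_type_algebra :: 'a ring)"
    by (rule field.subfieldI'[OF field_from_type_algebra M(1)]) (use M(2) in simp)
qed

lemma subring_type_closed:
  assumes "subring M (ring_of_type_algebra :: 'a::field ring)"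
  shows "0 \<in> M" "1 \<in> M" "x \<in> M \<Longrightarrow> - x \<in> M" "x \<in> M \<Longrightarrow> y \<in> M \<Longrightarrow> x + y \<in> M"
    "x \<in> M \<Longrightarrow> y \<in> M \<Longrightarrow> x - y \<in> M" "x \<in> M \<Longrightarrow> y \<in> M \<Longrightarrow> x * y \<in> M"
    "x \<in> M \<Longrightarrow> x ^ n \<in> M" "(\<And>i. i \<in> I \<Longrightarrow> f i \<in> M) \<Longrightarrow> sum f I \<in> M" "of_int k \<in> M" "of_nat m \<in> M"
proof -
  note M = assms[unfolded subring_type_iff]
  show one: "1 \<in> M" and neg: "x \<in> M \<Longrightarrow> - x \<in> M" for x using M by auto
  show add: "x \<in> M \<Longrightarrow> y \<in> M \<Longrightarrow> x + y \<in> M" and mult: "x \<in> M \<Longrightarrow> y \<in> M \<Longrightarrow> x * y \<in> M" for x y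
    using M by auto
  show zero: "0 \<in> M" using add[OF one neg[OF one]] by simp
  show "x \<in> M \<Longrightarrow> y \<in> M \<Longrightarrow> x - y \<in> M" for x y
    using add[of x "- y"] neg[of y] by simp
  show "x \<in> M \<Longrightarrow> x ^ n \<in> M" by (induction n) (auto intro: one mult)
  show "(\<And>i. i \<in> I \<Longrightarrow> f i \<in> M) \<Longrightarrow> sum f I \<in> M"
    by (induction I rule: infinite_finite_induct) (auto intro: zero add)
  show nat: "of_nat m \<in> M" for m by (induction m) (auto intro: zero one add)
  show "of_int k \<in> M" by (cases k) (auto intro: nat neg simp del: of_nat_Suc)
qed

lemma subfield_type_closed:
  assumes "subfield M (ring_of_type_algebra :: 'a::field_char_0 ring)"
  shows "x \<in> M \<Longrightarrow> inverse x \<in> M" "x \<in> M \<Longrightarrow> y \<in> M \<Longrightarrow> x / y \<in> M" "of_rat r \<in> M" "\<rat> \<subseteq> M"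
proof -
  note M = assms[unfolded subfield_type_iff]
  show inv: "x \<in> M \<Longrightarrow> inverse x \<in> M" for x using M by auto
  show div: "x \<in> M \<Longrightarrow> y \<in> M \<Longrightarrow> x / y \<in> M" for x y
    using M inv[of y] subring_type_closed(6)[of M x "inverse y"]
      by (simp add: field_class.field_divide_inverse)
  show rat: "of_rat r \<in> M" for r
    by (cases r) (use M subring_type_closed(9)[of M] div in \<open>auto simp: of_rat_rat\<close>)
  thus "\<rat> \<subseteq> M" by (auto elim!: Rats_cases)
qed

lemma subfield_Rats: "subfield \<rat> (ring_of_type_algebra :: 'a::field_char_0 ring)"
  by (auto simp: subfield_type_iff subring_type_iff)

lemma type_ring_combine_map:
  "length ks = length us \<Longrightarrow>
     ring.combine ring_of_type_algebra ks us = (\<Sum>i<length us. ks ! i * (us ! i :: 'a::field))"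
proof (induction ks us rule: list_induct2)
  case (Cons k ks u us)
  thus ?case by (simp add: sum.lessThan_Suc_shift del: sum.lessThan_Suc)
qed simp

lemma common_denominator:
  fixes r :: "nat \<Rightarrow> rat"
  shows "\<exists>d::int. d > 0 \<and> (\<forall>i<n. \<exists>k. of_int d * r i = of_int k)"
proof (induction n)
  case 0
  show ?case by (intro exI[of _ 1]) auto
next
  case (Suc n)
  then obtain d :: int where d: "d > 0" "\<forall>i<n. \<exists>k. of_int d * r i = of_int k"
    by blast
  obtain a b where ab: "r n = Rat.Fract a b" "b > 0" by (cases "r n")
  show ?case
  proof (rule exI[of _ "d * b"], intro conjI allI impI)
    show "d * b > 0" using d ab by simp
    fix i assume "i < Suc n"
    then consider "i < n" | "i = n" by linarith
    thus "\<exists>k. of_int (d * b) * r i = of_int k"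
    proof cases
      case 1
      then obtain k where "of_int d * r i = of_int k" using d by blast
      hence "of_int (d * b) * r i = of_int (b * k)" by (simp add: mult_ac)
      thus ?thesis by blast
    next
      case 2
      hence "of_int (d * b) * r i = of_int (d * a)" using ab by (simp add: Fract_of_int_quotient)
      thus ?thesis by (rule exI)
    qed
  qed
qed

text \<open>With \<open>N\<close> the dimension, \<open>N + 1\<close> indices force a dependence.
  Dependence is that of a list, so the \<open>f i\<close> may coincide, as the powers of a root of
  unity do.\<close>

lemma number_field_int_dependence:
  assumes "number_field (K :: 'a::field_char_0 set)"
  obtains N where "\<And>f. (\<And>i. i \<le> N \<Longrightarrow> f i \<in> K) \<Longrightarrow>
    \<exists>c::nat \<Rightarrow> int. (\<exists>i\<le>N. c i \<noteq> 0) \<and> (\<Sum>i\<le>N. of_int (c i) * f i) = 0"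
proof -
  obtain N where N: "type_ring.dimension N \<rat> K"
    using assms unfolding number_field_def type_ring.finite_dimension_def by blast
  have "\<exists>c::nat \<Rightarrow> int. (\<exists>i\<le>N. c i \<noteq> 0) \<and> (\<Sum>i\<le>N. of_int (c i) * f i) = 0"
    if f: "\<And>i. i \<le> N \<Longrightarrow> f i \<in> K" for f
  proof -
    define us where "us = map f [0..<Suc N]"
    have us: "set us \<subseteq> K" "length us = Suc N"
      using f by (auto simp: us_def less_Suc_eq_le simp del: upt_Suc)
    have "\<not> type_ring.independent \<rat> us"
      using type_ring.independent_length_le_dimension[OF subfield_Rats N _ us(1)] us(2) by auto
    then obtain ks
      where ks: "length ks = length us" "type_ring.combine ks us = 0" "set ks \<subseteq> \<rat>" "set ks \<noteq> {0}"
      by (rule type_ring.dependent_imp_non_trivial_combine[OF subfield_Rats, of us, rotated]) simp_all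
    have "\<exists>r. ks ! i = of_rat r" if "i < Suc N" for i
      using ks(1,3) us(2) that by (metis Rats_cases nth_mem subsetD)
    then obtain r where r: "\<And>i. i < Suc N \<Longrightarrow> ks ! i = of_rat (r i)" by metis
    obtain d :: int where d: "d > 0" "\<forall>i<Suc N. \<exists>k. of_int d * r i = of_int k"
      using common_denominator by blast
    then obtain c where c: "\<And>i. i < Suc N \<Longrightarrow> of_int d * r i = of_int (c i)"
      by metis
    have cks: "of_int (c i) = of_int d * ks ! i" if "i < Suc N" for i
      using c[OF that] r[OF that] by (metis of_rat_mult of_rat_of_int_eq)
    obtain i where i: "i < Suc N" "ks ! i \<noteq> 0"
    proof -
      \<comment> \<open>\<open>set ks \<noteq> {0}\<close> holds for the empty list too; only a
        nonempty one yields a nonzero coefficient.\<close>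
      have "set ks \<noteq> {}" using ks(1) us(2) by auto
      hence "\<not> set ks \<subseteq> {0}" using ks(4) subset_singletonD by metis
      then obtain k where "k \<in> set ks" "k \<noteq> 0" by blast
      thus ?thesis using that ks(1) us(2) by (metis in_set_conv_nth)
    qed
    have "c i \<noteq> 0" using cks[OF i(1)] i(2) d(1) by auto
    moreover have "(\<Sum>i\<le>N. of_int (c i) * f i) = 0"
    proof -
      have "(\<Sum>i\<le>N. of_int (c i) * f i) = (\<Sum>i<Suc N. of_int d * (ks ! i * us ! i))"
        unfolding lessThan_Suc_atMost[symmetric]
        by (intro sum.cong) (auto simp: cks us_def simp del: upt_Suc)
      also have "\<dots> = of_int d * type_ring.combine ks us"
        using type_ring_combine_map[OF ks(1)] us(2)
          by (simp add: sum_distrib_left del: sum.lessThan_Suc)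
      finally show ?thesis using ks(2) by simp
    qed
    ultimately show ?thesis using i(1) by (metis less_Suc_eq_le)
  qed
  thus ?thesis using that by blast
qed

text \<open>Descent: a relation whose coefficients are all divisible by \<open>q\<close> can be
  divided by \<open>q\<close>, which strictly lowers the sum of absolute values.\<close>

lemma int_relation_not_all_dvd:
  fixes f :: "nat \<Rightarrow> 'a::field_char_0" and q :: nat and c :: "nat \<Rightarrow> int"
  assumes "q > 1" "\<exists>i\<le>N. c i \<noteq> 0" "(\<Sum>i\<le>N. of_int (c i) * f i) = 0"
  shows "\<exists>c::nat \<Rightarrow> int. (\<exists>i\<le>N. \<not> int q dvd c i) \<and> (\<Sum>i\<le>N. of_int (c i) * f i) = 0"
  using assms(2,3)
proof (induction "\<Sum>i\<le>N. nat \<bar>c i\<bar>" arbitrary: c rule: less_induct)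
  case less
  show ?case
  proof (cases "\<exists>i\<le>N. \<not> int q dvd c i")
    case True
    thus ?thesis using less.prems by blast
  next
    case False
    define d where "d i = c i div int q" for i
    have cd: "c i = int q * d i" if "i \<le> N" for i using False that by (simp add: d_def)
    obtain i where i: "i \<le> N" "c i \<noteq> 0" using less.prems by blast
    have "(\<Sum>i\<le>N. nat \<bar>d i\<bar>) < (\<Sum>i\<le>N. nat \<bar>c i\<bar>)"
    proof (rule sum_strict_mono_ex1)
      show "\<forall>i\<in>{..N}. nat \<bar>d i\<bar> \<le> nat \<bar>c i\<bar>"
        using assms(1) by (auto simp: cd abs_mult nat_mult_distrib)
      have "1 * \<bar>d i\<bar> < int q * \<bar>d i\<bar>"
        using i cd[OF i(1)] assms(1) by (intro mult_strict_right_mono) auto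
      thus "\<exists>i\<in>{..N}. nat \<bar>d i\<bar> < nat \<bar>c i\<bar>"
        using i by (intro bexI[of _ i]) (auto simp: cd abs_mult)
    qed simp
    moreover have "\<exists>i\<le>N. d i \<noteq> 0" using i cd by auto
    moreover have "(\<Sum>i\<le>N. of_int (d i) * f i) = 0"
    proof -
      have "0 = (\<Sum>i\<le>N. of_int (int q) * (of_int (d i) * f i))"
        using less.prems(2) by (simp add: cd mult.assoc)
      also have "\<dots> = of_int (int q) * (\<Sum>i\<le>N. of_int (d i) * f i)"
        by (rule sum_distrib_left[symmetric])
      finally show ?thesis using assms(1) by simp
    qed
    ultimately show ?thesis by (rule less.hyps)
  qed
qed

section \<open>The ring of integers\<close>

lemma ring_of_integers_simps [simp]:
  "x \<in> carrier (ring_of_integers K) \<longleftrightarrow> x \<in> K \<and> algebraic_int x"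
  "x \<otimes>\<^bsub>ring_of_integers K\<^esub> y = x * y"
  "x \<oplus>\<^bsub>ring_of_integers K\<^esub> y = x + y"
  "\<one>\<^bsub>ring_of_integers K\<^esub> = 1"
  "\<zero>\<^bsub>ring_of_integers K\<^esub> = 0"
  by (simp_all add: ring_of_integers_def)

locale num_field =
  fixes K :: "'a::field_char_0 set"
  assumes number_field: "number_field K"
begin

definition OK :: "'a set" where
  "OK = {x \<in> K. algebraic_int x}"

lemma carrier_ring_of_integers: "carrier (ring_of_integers K) = OK"
  by (auto simp: OK_def)

lemma subfield_K: "subfield K ring_of_type_algebra"
  using number_field by (simp add: number_field_def)

lemmas subring_K = subfieldE(1)[OF subfield_K]

lemmas K_closed = subring_type_closed[OF subring_K] subfield_type_closed[OF subfield_K]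

lemma OK_subset: "OK \<subseteq> K"
  by (auto simp: OK_def)

lemma subring_OK: "subring OK ring_of_type_algebra"
  unfolding subring_type_iff OK_def
  using K_closed by (auto intro: algebraic_int_add_mult)

lemmas OK_closed = subring_type_closed[OF subring_OK]

lemma cring_OK: "cring (ring_of_integers K)"
proof -
  have "cring (ring_of_type_algebra\<lparr>carrier := OK\<rparr>)"
    using type_ring.subcring_iff[of OK] type_ring.subcringI'[OF subring_OK] by simp
  thus ?thesis by (simp add: ring_of_integers_def OK_def)
qed

lemma int_dependence:
  obtains N where "\<And>f (q::nat). q > 1 \<Longrightarrow> (\<And>i. i \<le> N \<Longrightarrow> f i \<in> K) \<Longrightarrow>
    \<exists>c::nat \<Rightarrow> int. (\<exists>i\<le>N. \<not> int q dvd c i) \<and> (\<Sum>i\<le>N. of_int (c i) * f i) = 0"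
proof -
  obtain N where N: "\<And>f. (\<And>i. i \<le> N \<Longrightarrow> f i \<in> K) \<Longrightarrow>
    \<exists>c::nat \<Rightarrow> int. (\<exists>i\<le>N. c i \<noteq> 0) \<and> (\<Sum>i\<le>N. of_int (c i) * f i) = 0"
    using number_field_int_dependence[OF number_field] by metis
  show ?thesis
  proof (rule that)
    fix f :: "nat \<Rightarrow> 'a" and q :: nat assume q: "q > 1" and f: "\<And>i. i \<le> N \<Longrightarrow> f i \<in> K"
    obtain c :: "nat \<Rightarrow> int"
      where c: "\<exists>i\<le>N. c i \<noteq> 0" "(\<Sum>i\<le>N. of_int (c i) * f i) = 0"
      using N[of f] f by blast
    show "\<exists>c::nat \<Rightarrow> int. (\<exists>i\<le>N. \<not> int q dvd c i) \<and> (\<Sum>i\<le>N. of_int (c i) * f i) = 0"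
      by (rule int_relation_not_all_dvd[OF q c])
  qed
qed

lemma power_relation:
  assumes "x \<in> K"
  obtains N and c :: "nat \<Rightarrow> int"
    where "\<exists>i\<le>N. c i \<noteq> 0" "(\<Sum>i\<le>N. of_int (c i) * x ^ i) = 0"
proof -
  obtain N where N: "\<And>f. (\<And>i. i \<le> N \<Longrightarrow> f i \<in> K) \<Longrightarrow>
    \<exists>c::nat \<Rightarrow> int. (\<exists>i\<le>N. c i \<noteq> 0) \<and> (\<Sum>i\<le>N. of_int (c i) * f i) = 0"
    using number_field_int_dependence[OF number_field] by metis
  show ?thesis using N[of "\<lambda>i. x ^ i"] K_closed(7)[OF assms] that by blast
qed

lemma int_multiple_integral:
  assumes x: "x \<in> K"
  obtains d :: int where "d \<noteq> 0" "of_int d * x \<in> OK"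
proof -
  obtain N and c :: "nat \<Rightarrow> int"
    where c: "\<exists>i\<le>N. c i \<noteq> 0" "(\<Sum>i\<le>N. of_int (c i) * x ^ i) = 0"
    using power_relation[OF x] .
  \<comment> \<open>The leading coefficient \<open>c m\<close> of the relation will serve as the
    multiplier.\<close>
  define m where "m = (GREATEST i. i \<le> N \<and> c i \<noteq> 0)"
  have m: "m \<le> N" "c m \<noteq> 0"
    using GreatestI_ex_nat[of "\<lambda>i. i \<le> N \<and> c i \<noteq> 0" N] c(1)
      by (auto simp: m_def)
  have gt: "c i = 0" if "i \<le> N" "m < i" for i
    using Greatest_le_nat[of "\<lambda>i. i \<le> N \<and> c i \<noteq> 0" i N] that
      by (auto simp: m_def)
  have eq: "(\<Sum>i\<le>m. of_int (c i) * x ^ i) = 0"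
    using c(2) gt m(1) by (subst (asm) sum.mono_neutral_right[of "{..N}" "{..m}"]) auto
  have m0: "m \<noteq> 0" using eq m(2) by (auto intro: Nat.gr0I)
  define y where "y = of_int (c m) * x"
  \<comment> \<open>The relation multiplied by \<open>c m ^ (m - 1)\<close> becomes monic in
    \<open>y = c m * x\<close>, because
    \<open>c m ^ (m - 1) * x ^ i = c m ^ (m - 1 - i) * y ^ i\<close> for
    \<open>i < m\<close>.\<close>
  define p where "p = Polynomial.monom 1 m + (\<Sum>i<m. Polynomial.monom (of_int (c i * c m ^ (m - 1 - i)) :: 'a) i)"
  have "Polynomial.degree (\<Sum>i<m. Polynomial.monom (of_int (c i * c m ^ (m - 1 - i)) :: 'a) i) < m"
    using m0 by (intro degree_sum_less) (auto intro: le_less_trans[OF degree_monom_le])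
  hence lead: "Polynomial.lead_coeff p = 1"
    unfolding p_def by (subst degree_add_eq_left) (auto simp: degree_monom_eq coeff_eq_0)
  have coeffs: "\<forall>i. Polynomial.coeff p i \<in> \<int>"
    by (auto simp: p_def coeff_sum intro!: Ints_add Ints_sum Ints_mult)
  have "poly p y = y ^ m + (\<Sum>i<m. of_int (c i * c m ^ (m - 1 - i)) * y ^ i)"
    by (simp add: p_def poly_monom poly_sum)
  also have "(\<Sum>i<m. of_int (c i * c m ^ (m - 1 - i)) * y ^ i) = (\<Sum>i<m. of_int (c m) ^ (m - 1) * (of_int (c i) * x ^ i))"
  proof (rule sum.cong)
    fix i assume "i \<in> {..<m}"
    hence "m - 1 = (m - 1 - i) + i" by simp
    hence "of_int (c m) ^ (m - 1) = (of_int (c m) ^ (m - 1 - i) * of_int (c m) ^ i :: 'a)"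
      by (metis power_add)
    thus "of_int (c i * c m ^ (m - 1 - i)) * y ^ i = of_int (c m) ^ (m - 1) * (of_int (c i) * x ^ i)"
      by (simp add: y_def power_mult_distrib mult_ac)
  qed simp
  also have "y ^ m = of_int (c m) ^ (m - 1) * (of_int (c m) * x ^ m)"
    using m0 by (cases m) (simp_all add: y_def power_mult_distrib mult_ac)
  finally have "poly p y = of_int (c m) ^ (m - 1) * (\<Sum>i\<le>m. of_int (c i) * x ^ i)"
    by (simp add: lessThan_Suc_atMost[symmetric] sum_distrib_left distrib_left add.commute)
  hence "algebraic_int y"
    using eq by (intro algebraic_int.intros[OF lead coeffs]) simp
  moreover have "y \<in> K" unfolding y_def using x by (intro K_closed)
  ultimately show ?thesis using that[OF m(2)] by (simp add: OK_def y_def)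
qed

text \<open>Families in \<open>OK\<close> that are independent modulo \<open>q\<close> have bounded
  size, so a largest one exists. By maximality it spans \<open>OK / q OK\<close> over the field with
  \<open>q\<close> elements, and the combinations with coefficients below \<open>q\<close> represent
  all residues.\<close>

lemma finite_representatives_mod:
  assumes q: "Factorial_Ring.prime (q::nat)"
  obtains F where "finite F" "F \<subseteq> OK" "\<And>x. x \<in> OK \<Longrightarrow> \<exists>y\<in>F. \<exists>z\<in>OK. x = y + of_nat q * z"
proof -
  define qO where "qO = (\<lambda>z. of_nat q * z) ` OK"
  have qO_add: "x + y \<in> qO" if xy: "x \<in> qO" "y \<in> qO" for x y
  proof -
    obtain a b where "x = of_nat q * a" "y = of_nat q * b" "a \<in> OK" "b \<in> OK"
      using xy by (auto simp: qO_def)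
    hence "x + y = of_nat q * (a + b)" "a + b \<in> OK" by (simp_all add: algebra_simps OK_closed)
    thus ?thesis unfolding qO_def by blast
  qed
  have qO_mult: "r * x \<in> qO" if xr: "x \<in> qO" "r \<in> OK" for x r
  proof -
    obtain a where "x = of_nat q * a" "a \<in> OK" using xr by (auto simp: qO_def)
    hence "r * x = of_nat q * (r * a)" "r * a \<in> OK"
      using xr by (simp_all add: algebra_simps OK_closed)
    thus ?thesis unfolding qO_def by blast
  qed
  have qO_int: "of_int k * x \<in> qO" if "int q dvd k" "x \<in> OK" for k x
  proof -
    obtain l where l: "k = int q * l" using \<open>int q dvd k\<close> by (rule dvdE)
    have "of_int k * x = of_nat q * (of_int l * x)" unfolding l by (simp add: mult_ac)
    thus ?thesis unfolding qO_def using that(2) OK_closed(6,9) by blast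
  qed
  \<comment> \<open>Linear independence of the residues of \<open>f 0, ..., f (m - 1)\<close> over
    the field with \<open>q\<close> elements.\<close>
  define ind where "ind m f \<longleftrightarrow> (\<forall>i<m. f i \<in> OK) \<and>
      (\<forall>c::nat\<Rightarrow>int. (\<Sum>i<m. of_int (c i) * f i) \<in> qO \<longrightarrow> (\<forall>i<m. int q dvd c i))" for m f
  obtain N where N: "\<And>f (q::nat). q > 1 \<Longrightarrow> (\<And>i. i \<le> N \<Longrightarrow> f i \<in> K) \<Longrightarrow>
    \<exists>c::nat \<Rightarrow> int. (\<exists>i\<le>N. \<not> int q dvd c i) \<and> (\<Sum>i\<le>N. of_int (c i) * f i) = 0"
    using int_dependence by metis
  have bound: "m \<le> N" if ind: "ind m f" for m f
  proof (rule ccontr)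
    assume "\<not> m \<le> N"
    hence "\<And>i. i \<le> N \<Longrightarrow> f i \<in> K"
      using ind OK_subset by (auto simp: ind_def)
    with N[of q f] obtain c :: "nat \<Rightarrow> int"
      where c: "\<exists>i\<le>N. \<not> int q dvd c i" "(\<Sum>i\<le>N. of_int (c i) * f i) = 0"
      using prime_gt_1_nat[OF q] by auto
    \<comment> \<open>Padding with zeros turns the relation among the first \<open>N + 1\<close>
      members into one among all \<open>m\<close>.\<close>
    define d where "d i = (if i \<le> N then c i else 0)" for i
    have "(\<Sum>i<m. of_int (d i) * f i) = (\<Sum>i\<le>N. of_int (c i) * f i)"
      using \<open>\<not> m \<le> N\<close>
        by (intro sum.mono_neutral_cong_right) (auto simp: d_def)
    hence "(\<Sum>i<m. of_int (d i) * f i) \<in> qO" using c(2) OK_closed(1) by (auto simp: qO_def)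
    hence "\<forall>i<m. int q dvd d i" using ind unfolding ind_def by blast
    thus False using c(1) \<open>\<not> m \<le> N\<close> by (auto simp: d_def split: if_splits)
  qed
  have ex0: "\<exists>m. \<exists>f. ind m f" by (intro exI[of _ 0]) (auto simp: ind_def)
  define m where "m = (GREATEST m. \<exists>f. ind m f)"
  have "\<exists>f. ind m f" unfolding m_def using ex0 bound
    by (intro GreatestI_ex_nat[of "\<lambda>m. \<exists>f. ind m f" N]) auto
  then obtain f where f: "ind m f" by blast
  have max: "\<not> ind (Suc m) g" for g
  proof
    assume "ind (Suc m) g"
    hence "Suc m \<le> m" unfolding m_def using bound by (intro Greatest_le_nat[of _ _ N]) auto
    thus False by simp
  qed
  have fO: "f i \<in> OK" if "i < m" for i using f that by (auto simp: ind_def)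
  define F where "F = (\<lambda>a. \<Sum>i<m. of_int (a i) * f i) ` ({..<m} \<rightarrow>\<^sub>E {0..<int q})"
  show ?thesis
  proof (rule that)
    show "finite F" unfolding F_def by (intro finite_imageI finite_PiE) auto
    show "F \<subseteq> OK" unfolding F_def using fO by (auto intro!: OK_closed(6,8,9))
    fix x assume x: "x \<in> OK"
    have "\<not> ind (Suc m) (f(m := x))" by (rule max)
    moreover have "\<forall>i<Suc m. (f(m := x)) i \<in> OK" using fO x by auto
    ultimately obtain c :: "nat \<Rightarrow> int" where
      c: "(\<Sum>i<Suc m. of_int (c i) * (f(m := x)) i) \<in> qO" "\<not> (\<forall>i<Suc m. int q dvd c i)"
      unfolding ind_def by blast
    have sumc: "(\<Sum>i<m. of_int (c i) * f i) + of_int (c m) * x \<in> qO"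
      using c(1) by simp
    \<comment> \<open>If \<open>q\<close> divided the coefficient of \<open>x\<close>, that term
      could be dropped modulo \<open>q\<close>, and the independence of \<open>f\<close> would make
      all coefficients divisible.\<close>
    have ndvd: "\<not> int q dvd c m"
    proof
      assume dv: "int q dvd c m"
      have "of_int (- c m) * x \<in> qO" using dv x by (intro qO_int) simp_all
      from qO_add[OF sumc this] have "(\<Sum>i<m. of_int (c i) * f i) \<in> qO" by simp
      hence "\<forall>i<m. int q dvd c i" using f unfolding ind_def by blast
      thus False using dv c(2) less_Suc_eq by auto
    qed
    have "coprime (c m) (int q)"
      using ndvd q by (metis coprime_commute prime_imp_coprime prime_nat_int_transfer)
    then obtain e k where e: "e * c m + k * int q = 1"
      using bezout_int[of "c m" "int q"] by (metis coprime_imp_gcd_eq_1)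
    \<comment> \<open>With \<open>e\<close> inverse to \<open>c m\<close> modulo \<open>q\<close>,
      the relation solves to \<open>x\<close> congruent to the sum of the
      \<open>- e * c i * f i\<close>.\<close>
    define a where "a = (\<lambda>i\<in>{..<m}. (- e * c i) mod int q)"
    define y where "y = (\<Sum>i<m. of_int (a i) * f i)"
    have yF: "y \<in> F" unfolding y_def F_def a_def
      using prime_gt_0_nat[OF q] by (intro imageI) (auto split: if_splits)
    have "x - y \<in> qO"
    proof -
      have 1: "of_int e * ((\<Sum>i<m. of_int (c i) * f i) + of_int (c m) * x) \<in> qO"
        using sumc by (intro qO_mult OK_closed)
      have 2: "of_int (k * int q) * x \<in> qO" using x by (intro qO_int) auto
      have "int q dvd (- e * c i - a i)" if "i < m" for i
        using that by (simp add: a_def minus_mod_eq_mult_div)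
      hence "of_int (- e * c i - a i) * f i \<in> qO" if "i < m" for i
        using that fO by (intro qO_int) auto
      hence 3: "(\<Sum>i<m. of_int (- e * c i - a i) * f i) \<in> qO"
      proof -
        have "0 \<in> qO" using OK_closed(1) by (auto simp: qO_def)
        moreover have "M \<le> m \<Longrightarrow> (\<Sum>i<M. of_int (- e * c i - a i) * f i) \<in> qO" for M
          using \<open>\<And>i. i < m \<Longrightarrow> of_int (- e * c i - a i) * f i \<in> qO\<close> \<open>0 \<in> qO\<close>
          by (induction M) (auto intro!: qO_add simp del: of_int_diff of_int_mult of_int_minus)
        ultimately show ?thesis by blast
      qed
      have "x = of_int (e * c m + k * int q) * x" unfolding e by simp
      also have "\<dots> - y = of_int e * ((\<Sum>i<m. of_int (c i) * f i) + of_int (c m) * x) + of_int (k * int q) * x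
          + (\<Sum>i<m. of_int (- e * c i - a i) * f i)"
        by (simp add: y_def algebra_simps sum_distrib_left sum_subtractf sum_negf sum.distrib)
      finally show ?thesis using qO_add[OF qO_add[OF 1 2] 3] by simp
    qed
    then obtain z where "z \<in> OK" "x - y = of_nat q * z" by (auto simp: qO_def)
    thus "\<exists>y\<in>F. \<exists>z\<in>OK. x = y + of_nat q * z"
      using yF by (intro bexI[of _ y] bexI[of _ z]) (auto simp: algebra_simps)
  qed
qed

text \<open>The form in which finiteness of \<open>OK / q OK\<close> is applied: to powers of an
  element it gives inverses modulo \<open>P\<close> or local nilpotence, and to the sequence
  \<open>g^n q\<close> it gives integrality of \<open>g\<close>.\<close>

lemma pigeonhole_mod:
  assumes q: "Factorial_Ring.prime (q::nat)" and g: "\<And>n::nat. g n \<in> OK"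
  obtains i j z where "i < j" "z \<in> OK" "g j = g i + of_nat q * z"
proof -
  obtain F where F: "finite F" "F \<subseteq> OK" "\<And>x. x \<in> OK \<Longrightarrow> \<exists>y\<in>F. \<exists>z\<in>OK. x = y + of_nat q * z"
    using finite_representatives_mod[OF q] by metis
  have "\<forall>n. \<exists>y z. y \<in> F \<and> z \<in> OK \<and> g n = y + of_nat q * z"
    using F(3) g by blast
  then obtain y z
    where yz: "\<And>n. y n \<in> F" "\<And>n. z n \<in> OK" "\<And>n. g n = y n + of_nat q * z n"
    by metis
  have "\<not> inj y"
    using finite_subset[OF _ F(1), of "range y"] yz(1) by (auto dest: finite_imageD)
  then obtain i j where "i < j" "y i = y j"
    by (metis injI linorder_neqE_nat)
  thus ?thesis
    using that[of i j "z j - z i"] yz by (simp add: OK_closed algebra_simps)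
qed

end

section \<open>Nonzero prime ideals\<close>

context num_field
begin

text \<open>After division by a power of \<open>a\<close>, the lowest nonzero coefficient of an
  integral relation for \<open>a\<close> is a multiple of \<open>a\<close>. This puts a nonzero
  rational integer into each nonzero ideal and later bounds the exponent of
  \<open>a\<close>.\<close>

lemma integer_multiple_nonzero:
  assumes a: "a \<in> OK" "a \<noteq> 0"
  obtains k :: int and b where "k \<noteq> 0" "b \<in> OK" "of_int k = a * b"
proof -
  obtain N and c :: "nat \<Rightarrow> int"
    where c: "\<exists>i\<le>N. c i \<noteq> 0" "(\<Sum>i\<le>N. of_int (c i) * a ^ i) = 0"
    using power_relation[of a] a OK_subset by blast
  define m where "m = (LEAST i. i \<le> N \<and> c i \<noteq> 0)"
  have m: "m \<le> N" "c m \<noteq> 0" using LeastI_ex[OF c(1)] by (auto simp: m_def)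
  have lt: "c i = 0" if "i < m" for i
    using not_less_Least[of i "\<lambda>i. i \<le> N \<and> c i \<noteq> 0"] that m(1)
      by (auto simp: m_def)
  define b where "b = - (\<Sum>i\<in>{m<..N}. of_int (c i) * a ^ (i - Suc m))"
  have "0 = (\<Sum>i\<in>{m..N}. of_int (c i) * a ^ i)"
    unfolding c(2)[symmetric] by (rule sum.mono_neutral_right) (auto simp: lt)
  also have "{m..N} = insert m {m<..N}" using m by auto
  also have "(\<Sum>i\<in>insert m {m<..N}. of_int (c i) * a ^ i)
      = of_int (c m) * a ^ m + (\<Sum>i\<in>{m<..N}. of_int (c i) * a ^ i)" by simp
  also have "(\<Sum>i\<in>{m<..N}. of_int (c i) * a ^ i) = (\<Sum>i\<in>{m<..N}. a ^ m * (a * (of_int (c i) * a ^ (i - Suc m))))"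
  proof (rule sum.cong)
    fix i assume "i \<in> {m<..N}"
    hence "i = m + Suc (i - Suc m)" by auto
    hence "a ^ i = a ^ m * (a * a ^ (i - Suc m))" by (metis power_Suc power_add)
    thus "of_int (c i) * a ^ i = a ^ m * (a * (of_int (c i) * a ^ (i - Suc m)))" by simp
  qed simp
  also have "of_int (c m) * a ^ m + \<dots> = a ^ m * (of_int (c m) - a * b)"
    by (simp add: b_def sum_distrib_left algebra_simps)
  finally have "of_int (c m) = a * b" using a by simp
  moreover have "b \<in> OK" unfolding b_def using a by (intro OK_closed)
  ultimately show ?thesis using that m(2) by blast
qed

lemma ideal_closed:
  assumes "ideal I (ring_of_integers K)"
  shows "I \<subseteq> OK" "0 \<in> I" "x \<in> I \<Longrightarrow> y \<in> I \<Longrightarrow> x + y \<in> I" "x \<in> I \<Longrightarrow> r \<in> OK \<Longrightarrow> r * x \<in> I"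
    "x \<in> I \<Longrightarrow> r \<in> OK \<Longrightarrow> x * r \<in> I" "x \<in> I \<Longrightarrow> - x \<in> I" "x \<in> I \<Longrightarrow> y \<in> I \<Longrightarrow> x - y \<in> I"
proof -
  interpret ideal I "ring_of_integers K" by fact
  show "I \<subseteq> OK" using a_subset carrier_ring_of_integers by simp
  show "0 \<in> I" using additive_subgroup.zero_closed[OF additive_subgroup_axioms] by simp
  show add: "x \<in> I \<Longrightarrow> y \<in> I \<Longrightarrow> x + y \<in> I" for x y
    using additive_subgroup.a_closed[OF additive_subgroup_axioms, of x y] by simp
  show l: "x \<in> I \<Longrightarrow> r \<in> OK \<Longrightarrow> r * x \<in> I" for x r
    using I_l_closed[of x r] by (simp add: OK_def)
  show "x \<in> I \<Longrightarrow> r \<in> OK \<Longrightarrow> x * r \<in> I" for x r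
    by (metis l mult.commute)
  have "- 1 \<in> OK" by (intro OK_closed)
  thus neg: "x \<in> I \<Longrightarrow> - x \<in> I" for x using l[of x "- 1"] by simp
  show "x \<in> I \<Longrightarrow> y \<in> I \<Longrightarrow> x - y \<in> I" for x y
    using add[of x "- y"] neg[of y] by simp
qed

end

locale num_field_prime = num_field K for K :: "'a::field_char_0 set" +
  fixes P :: "'a set"
  assumes P_nonzero_prime: "P \<in> nonzero_primes K"
begin

lemma primeideal_P: "primeideal P (ring_of_integers K)" and P_neq_0: "P \<noteq> {0}"
  using P_nonzero_prime by (auto simp: nonzero_primes_def)

lemma ideal_P: "ideal P (ring_of_integers K)"
  using primeideal_P primeideal.axioms(1) by blast

lemmas P_closed = ideal_closed[OF ideal_P]

lemma one_notin_P: "1 \<notin> P"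
proof
  interpret primeideal P "ring_of_integers K" by (rule primeideal_P)
  assume "1 \<in> P"
  hence "P = carrier (ring_of_integers K)" using one_imp_carrier by simp
  thus False using I_notcarr by simp
qed

lemma P_prime: "x \<in> OK \<Longrightarrow> y \<in> OK \<Longrightarrow> x * y \<in> P \<longleftrightarrow> x \<in> P \<or> y \<in> P"
  using primeideal.I_prime[OF primeideal_P, of x y] P_closed(4,5) by (auto simp: OK_def)

lemma P_power: "x \<in> OK \<Longrightarrow> x ^ n \<in> P \<Longrightarrow> x \<in> P"
  by (induction n) (auto simp: one_notin_P P_prime OK_closed)

lemma compl_P_mult: "x \<in> OK - P \<Longrightarrow> y \<in> OK - P \<Longrightarrow> x * y \<in> OK - P"
  using P_prime OK_closed by auto

lemma prime_in_P: obtains q :: nat where "Factorial_Ring.prime q" "of_nat q \<in> P"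
proof -
  obtain a where a: "a \<in> P" "a \<noteq> 0" using P_neq_0 P_closed(2) by blast
  obtain k :: int and b where k: "k \<noteq> 0" "b \<in> OK" "of_int k = a * b"
    using integer_multiple_nonzero[of a] a P_closed(1) by blast
  have kP: "of_int k \<in> P" using k a P_closed(5) by simp
  have "of_nat (nat \<bar>k\<bar>) \<in> P" using kP P_closed(6)[OF kP] by (cases "k \<ge> 0") auto
  moreover have "nat \<bar>k\<bar> > 0" using k by simp
  moreover have "\<exists>q::nat. Factorial_Ring.prime q \<and> of_nat q \<in> P" if "of_nat n \<in> P" "n > 0" for n
    using that
  proof (induction n rule: less_induct)
    case (less n)
    have "n \<noteq> 1" using less.prems one_notin_P by auto
    then obtain q where q: "Factorial_Ring.prime q" "q dvd n" using prime_factor_nat by blast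
    then obtain m where m: "n = q * m" by blast
    have "(of_nat q :: 'a) * of_nat m \<in> P" using less.prems(1) by (simp add: m)
    hence "of_nat q \<in> P \<or> of_nat m \<in> P" using P_prime OK_closed(10) by blast
    moreover have "m < n" "m > 0" using less.prems(2) prime_gt_1_nat[OF q(1)] by (auto simp: m)
    ultimately show ?case using less.IH[of m] q(1) by blast
  qed
  ultimately show ?thesis using that by blast
qed

lemma of_int_in_P_iff:
  assumes q: "Factorial_Ring.prime (q::nat)" "of_nat q \<in> P"
  shows "of_int k \<in> P \<longleftrightarrow> int q dvd k"
proof
  assume k: "of_int k \<in> P"
  show "int q dvd k"
  proof (rule ccontr)
    assume "\<not> int q dvd k"
    hence "coprime k (int q)"
      using q by (metis coprime_commute prime_imp_coprime prime_nat_int_transfer)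
    then obtain e l where e: "e * k + l * int q = 1"
      using bezout_int[of k "int q"] by (metis coprime_imp_gcd_eq_1)
    have "of_int e * of_int k + of_int l * of_nat q \<in> P"
      using k q(2) by (intro P_closed OK_closed)
    also have "of_int e * of_int k + of_int l * of_nat q = (of_int (e * k + l * int q) :: 'a)"
      by simp
    finally show False using e one_notin_P by simp
  qed
next
  assume "int q dvd k"
  then obtain l where "k = int q * l" by blast
  thus "of_int k \<in> P" using P_closed(5)[OF q(2), of "of_int l"] OK_closed by simp
qed

lemma lies_over_rational_iff:
  assumes q: "Factorial_Ring.prime (q::nat)"
  shows "lies_over_rational P q \<longleftrightarrow> of_nat q \<in> P"
proof
  assume "lies_over_rational P q"
  moreover have "(of_nat q :: 'a) \<in> range (\<lambda>k. of_int (int q * k))"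
    by (rule range_eqI[of _ _ 1]) simp
  ultimately show "of_nat q \<in> P" by (auto simp: lies_over_rational_def)
next
  assume qP: "of_nat q \<in> P"
  show "lies_over_rational P q"
    unfolding lies_over_rational_def
  proof (intro equalityI subsetI)
    fix x assume "x \<in> P \<inter> \<int>"
    then obtain k where k: "x = of_int k" "of_int k \<in> P" by (auto elim!: Ints_cases)
    then obtain l where "k = int q * l" using of_int_in_P_iff[OF q qP] by blast
    thus "x \<in> range (\<lambda>k. of_int (int q * k))" using k(1) by blast
  next
    fix x assume "x \<in> range (\<lambda>k. of_int (int q * k) :: 'a)"
    then obtain k where "x = of_int (int q * k)" by blast
    thus "x \<in> P \<inter> \<int>" using of_int_in_P_iff[OF q qP, of "int q * k"] by simp
  qed
qed

lemma prime_below_eq: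
  assumes q: "Factorial_Ring.prime (q::nat)" "of_nat q \<in> P"
  shows "prime_below P = q"
  unfolding prime_below_def
proof (rule the_equality)
  show "Factorial_Ring.prime q \<and> lies_over_rational P q"
    using q lies_over_rational_iff by blast
  fix r :: nat assume r: "Factorial_Ring.prime r \<and> lies_over_rational P r"
  hence "of_int (int r) \<in> P" using lies_over_rational_iff by auto
  hence "q dvd r" using of_int_in_P_iff[OF q, of "int r"] by simp
  thus "r = q" using r q primes_dvd_imp_eq by blast
qed

definition q :: nat where "q = prime_below P"

lemma prime_q: "Factorial_Ring.prime q" and q_in_P: "of_nat q \<in> P"
  using prime_in_P prime_below_eq unfolding q_def by metis+

lemma lies_over_q: "lies_over_rational P q"
  using prime_q q_in_P lies_over_rational_iff by blast

text \<open>The powers of \<open>x\<close> repeat modulo \<open>q\<close>, so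
  \<open>x^i (1 - x^(j - i)) \<in> P\<close>, and \<open>x^i\<close> cancels because
  \<open>P\<close> is prime. In other words, nonzero primes are maximal.\<close>

lemma inverse_mod_P:
  assumes x: "x \<in> OK" "x \<notin> P"
  obtains y where "y \<in> OK" "1 - y * x \<in> P"
proof -
  obtain i j z where ij: "i < j" "z \<in> OK" "x ^ j = x ^ i + of_nat q * z"
    using pigeonhole_mod[OF prime_q, of "\<lambda>n. x ^ n"] OK_closed(7)[OF x(1)] by blast
  have j: "j = i + Suc (j - Suc i)" using ij by simp
  have "x ^ j = x ^ i * (x ^ (j - Suc i) * x)"
    by (subst j) (simp only: power_add power_Suc mult_ac)
  hence "x ^ i * (1 - x ^ (j - Suc i) * x) = - (of_nat q * z)"
    using ij(3) by (simp add: algebra_simps)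
  hence "x ^ i * (1 - x ^ (j - Suc i) * x) \<in> P" using P_closed(5,6) q_in_P ij by simp
  moreover have "x ^ i \<notin> P" using P_power x by blast
  moreover have "x ^ i \<in> OK" "1 - x ^ (j - Suc i) * x \<in> OK"
    using x by (auto intro!: OK_closed)
  ultimately have "1 - x ^ (j - Suc i) * x \<in> P" using P_prime by blast
  thus ?thesis using that[of "x ^ (j - Suc i)"] OK_closed(7)[OF x(1)] by blast
qed

text \<open>The element found here witnesses that \<open>P\<close> is an associated prime of \<open>OK / q OK\<close>: multiply
  \<open>1\<close> successively by powers of generators of \<open>P\<close>, as long as the product does not vanish in the
  localization at \<open>P\<close>.\<close>

lemma ex_inverse_element:
  obtains g where "g \<in> K" "g \<notin> OK" "\<And>x. x \<in> P \<Longrightarrow> g * x \<in> OK"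
proof -
  define qO where "qO = (\<lambda>z. of_nat q * z) ` OK"
  have qO_P: "x \<in> P" if "x \<in> qO" for x
    using that P_closed(5)[OF q_in_P] by (auto simp: qO_def)
  have qO_mult: "x * r \<in> qO" if "x \<in> qO" "r \<in> OK" for x r
    using that OK_closed(6) by (auto simp: qO_def mult.assoc)
  \<comment> \<open>\<open>Z b\<close> says that the residue of \<open>b\<close> in
    \<open>OK / q OK\<close> vanishes in the localization at \<open>P\<close>.\<close>
  define Z where "Z b \<longleftrightarrow> (\<exists>s\<in>OK - P. s * b \<in> qO)" for b
  have Z_mult: "Z (b * r)" if "Z b" "r \<in> OK" for b r
    using that qO_mult unfolding Z_def by (metis mult.assoc)
  \<comment> \<open>Elements of \<open>P\<close> are nilpotent there: two powers agree modulo
    \<open>q\<close>, so \<open>p^i\<close> is killed by \<open>1 - p^(j - i)\<close>, which lies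
    outside \<open>P\<close>.\<close>
  have Z_power: "\<exists>k. Z (p ^ k)" if p: "p \<in> P" for p
  proof -
    have pO: "p \<in> OK" using p P_closed(1) by blast
    obtain i j z where ij: "i < j" "z \<in> OK" "p ^ j = p ^ i + of_nat q * z"
      using pigeonhole_mod[OF prime_q, of "\<lambda>n. p ^ n"] OK_closed(7)[OF pO] by blast
    have j: "j = i + Suc (j - Suc i)" using ij by simp
    have "p ^ j = p ^ i * (p ^ (j - Suc i) * p)"
      by (subst j) (simp only: power_add power_Suc mult_ac)
    hence "(1 - p ^ (j - Suc i) * p) * p ^ i = of_nat q * (- z)"
      using ij(3) by (simp add: algebra_simps)
    hence "(1 - p ^ (j - Suc i) * p) * p ^ i \<in> qO"
      unfolding qO_def using OK_closed(3) ij by blast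
    moreover have "1 - p ^ (j - Suc i) * p \<in> OK" using pO by (intro OK_closed)
    moreover have "1 - p ^ (j - Suc i) * p \<notin> P"
    proof
      assume "1 - p ^ (j - Suc i) * p \<in> P"
      moreover have "p ^ (j - Suc i) * p \<in> P" using p pO by (intro P_closed(4) OK_closed)
      ultimately have "(1 - p ^ (j - Suc i) * p) + p ^ (j - Suc i) * p \<in> P"
        by (rule P_closed(3))
      thus False using one_notin_P by simp
    qed
    ultimately show ?thesis unfolding Z_def by blast
  qed
  have not_Z_1: "\<not> Z 1" unfolding Z_def using qO_P by auto
  have "\<exists>b\<in>OK. \<not> Z b \<and> (\<forall>p\<in>F. Z (b * p))" if "finite F" "F \<subseteq> P" for F
    using that
  proof (induction F rule: finite_induct)
    case empty
    show ?case using not_Z_1 OK_closed(2) by blast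
  next
    case (insert p F)
    then obtain b where b: "b \<in> OK" "\<not> Z b" "\<forall>p\<in>F. Z (b * p)" by auto
    have pO: "p \<in> OK" using insert.prems P_closed(1) by blast
    obtain k0 where "Z (p ^ k0)" using Z_power insert.prems by blast
    hence ex: "\<exists>k. Z (b * p ^ k)" using Z_mult[OF _ b(1)] by (metis mult.commute)
    \<comment> \<open>By minimality \<open>b * p^(k - 1)\<close> survives in the localization while
      \<open>p\<close> kills it.\<close>
    define k where "k = (LEAST k. Z (b * p ^ k))"
    have k: "Z (b * p ^ k)" using LeastI_ex[OF ex] by (simp add: k_def)
    have k0: "k \<noteq> 0" using k b(2) by (cases k) auto
    have "\<not> Z (b * p ^ (k - 1))"
      using not_less_Least[of "k - 1" "\<lambda>k. Z (b * p ^ k)"] k0 unfolding k_def by auto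
    moreover have "Z (b * p ^ (k - 1) * p)"
      using k k0 by (cases k) (auto simp: mult_ac)
    moreover have "Z (b * p ^ (k - 1) * p')" if "p' \<in> F" for p'
      using Z_mult[of "b * p'" "p ^ (k - 1)"] b(3) that OK_closed(7)[OF pO] by (simp add: mult_ac)
    moreover have "b * p ^ (k - 1) \<in> OK" using b pO by (intro OK_closed)
    ultimately show ?case by blast
  qed
  note step = this
  obtain F0 where F0: "finite F0" "F0 \<subseteq> OK" "\<And>x. x \<in> OK \<Longrightarrow> \<exists>y\<in>F0. \<exists>z\<in>OK. x = y + of_nat q * z"
    using finite_representatives_mod[OF prime_q] by metis
  \<comment> \<open>Finitely many generators of \<open>P\<close> modulo \<open>q\<close>, as
    \<open>q\<close> itself lies in \<open>P\<close>.\<close>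
  define F where "F = F0 \<inter> P"
  have F: "finite F" "F \<subseteq> P" using F0 by (auto simp: F_def)
  have F_rep: "\<exists>y\<in>F. \<exists>z\<in>OK. x = y + of_nat q * z" if x: "x \<in> P" for x
  proof -
    obtain y z where yz: "y \<in> F0" "z \<in> OK" "x = y + of_nat q * z"
      using F0(3) x P_closed(1) by blast
    have "x - of_nat q * z \<in> P" using that yz q_in_P by (intro P_closed)
    thus ?thesis using yz by (auto simp: F_def)
  qed
  obtain b where b: "b \<in> OK" "\<not> Z b" "\<forall>p\<in>F. Z (b * p)"
    using step[OF F] by blast
  \<comment> \<open>One common denominator for all generators: the product of their individual
    witnesses.\<close>
  have "\<exists>s\<in>OK - P. \<forall>p\<in>F. s * b * p \<in> qO"
    using F(1) b(3)
  proof (induction F rule: finite_induct)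
    case empty
    show ?case using one_notin_P OK_closed(2) by blast
  next
    case (insert p F)
    then obtain s t
      where s: "s \<in> OK - P" "\<forall>p\<in>F. s * b * p \<in> qO" and t: "t \<in> OK - P" "t * (b * p) \<in> qO"
      by (auto simp: Z_def)
    have "s * t \<in> OK - P" using compl_P_mult[OF s(1) t(1)] .
    moreover have "s * t * b * p \<in> qO"
      using qO_mult[OF t(2), of s] s(1) by (simp add: mult_ac)
    moreover have "s * t * b * p' \<in> qO" if "p' \<in> F" for p'
      using qO_mult[OF bspec[OF s(2) that], of t] t(1) by (simp add: mult_ac)
    ultimately show ?case by blast
  qed
  then obtain s where s: "s \<in> OK - P" "\<And>p. p \<in> F \<Longrightarrow> s * b * p \<in> qO"
    by blast
  have q0: "(of_nat q :: 'a) \<noteq> 0" using prime_gt_0_nat[OF prime_q] by simp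
  have sbO: "s * b \<in> OK" using s b OK_closed(6) by blast
  \<comment> \<open>Division by \<open>q\<close> turns the annihilated residue into the element
    sought: \<open>s * b * P\<close> lies in \<open>q OK\<close>, whereas \<open>s * b\<close> does
    not, since otherwise \<open>Z b\<close> would hold.\<close>
  show ?thesis
  proof (rule that[of "s * b / of_nat q"])
    show "s * b / of_nat q \<in> K" using K_closed(12)[OF subsetD[OF OK_subset sbO] K_closed(10)] .
    show "s * b / of_nat q \<notin> OK"
    proof
      assume "s * b / of_nat q \<in> OK"
      hence "of_nat q * (s * b / of_nat q) \<in> qO" unfolding qO_def by (rule imageI)
      hence "s * b \<in> qO" using q0 by simp
      thus False using b(2) s(1) unfolding Z_def by blast
    qed
    fix x assume "x \<in> P"
    then obtain y z where yz: "y \<in> F" "z \<in> OK" "x = y + of_nat q * z" using F_rep by blast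
    obtain u where u: "u \<in> OK" "s * b * y = of_nat q * u"
      using s(2)[OF yz(1)] by (auto simp: qO_def)
    have "s * b / of_nat q * x = u + s * b * z" using u(2) q0 yz(3) by (simp add: field_simps)
    thus "s * b / of_nat q * x \<in> OK" using u sbO yz by (simp add: OK_closed)
  qed
qed

text \<open>\<open>P\<close> is principal in the localization. As \<open>g\<close> is not integral,
  some \<open>u \<in> P\<close> has \<open>g u \<notin> P\<close>; then \<open>s = g u\<close> works
  because \<open>s x = u (g x)\<close> with \<open>g x \<in> OK\<close>.\<close>

lemma ex_uniformizer:
  obtains u s where "u \<in> P" "s \<in> OK - P" "\<And>x. x \<in> P \<Longrightarrow> \<exists>y\<in>OK. s * x = u * y"
proof -
  obtain g where g: "g \<in> K" "g \<notin> OK" "\<And>x. x \<in> P \<Longrightarrow> g * x \<in> OK"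
    using ex_inverse_element by metis
  have "\<exists>u\<in>P. g * u \<notin> P"
  proof (rule ccontr)
    assume "\<not> (\<exists>u\<in>P. g * u \<notin> P)"
    hence gP: "g * x \<in> P" if "x \<in> P" for x using that by blast
    \<comment> \<open>All \<open>g^n q\<close> stay in \<open>P\<close>, hence in \<open>OK\<close>,
      so two of them agree modulo \<open>q OK\<close>; cancelling \<open>q\<close> makes
      \<open>g^j - g^i\<close> an algebraic integer.\<close>
    have "g ^ n * of_nat q \<in> P" for n
      by (induction n) (use gP q_in_P in \<open>auto simp: mult.assoc\<close>)
    hence "g ^ n * of_nat q \<in> OK" for n using P_closed(1) by blast
    then obtain i j z
      where ij: "i < j" "z \<in> OK" "g ^ j * of_nat q = g ^ i * of_nat q + of_nat q * z"
      using pigeonhole_mod[OF prime_q, of "\<lambda>n. g ^ n * of_nat q"] by metis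
    have "of_nat q * (g ^ j - g ^ i) = of_nat q * z" using ij(3) by (simp add: algebra_simps)
    hence z: "g ^ j - g ^ i = z" using prime_gt_0_nat[OF prime_q] by simp
    define f :: "'a poly" where "f = Polynomial.monom 1 j - Polynomial.monom 1 i"
    have deg: "Polynomial.degree f = j" unfolding f_def diff_conv_add_uminus using ij(1)
      by (subst degree_add_eq_left) (simp_all add: degree_monom_eq)
    have "algebraic_int g"
    proof (rule algebraic_int_root)
      show "algebraic_int z" using ij(2) by (simp add: OK_def)
      show "poly f g = z" using z by (simp add: f_def poly_monom)
      show "\<forall>i. Polynomial.coeff f i \<in> \<int>" by (auto simp: f_def)
      show "Polynomial.lead_coeff f = 1" using deg ij(1) by (simp add: f_def)
      show "Polynomial.degree f > 0" using deg ij(1) by simp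
    qed
    thus False using g by (simp add: OK_def)
  qed
  then obtain u where u: "u \<in> P" "g * u \<notin> P" by blast
  show ?thesis
  proof (rule that[of u "g * u"])
    show "g * u \<in> OK - P" using u g(3) by blast
    fix x assume "x \<in> P"
    thus "\<exists>y\<in>OK. g * u * x = u * y" using g(3) by (intro bexI[of _ "g * x"]) auto
  qed (use u in auto)
qed

end

section \<open>Powers of a prime ideal and the valuation\<close>

context num_field_prime
begin

definition Pw :: "nat \<Rightarrow> 'a set" where
  "Pw n = P [^]\<^bsub>ideals_set (ring_of_integers K)\<^esub> n"

lemma Pw_0: "Pw 0 = OK"
  by (simp add: Pw_def nat_pow_def ideals_set_def carrier_ring_of_integers)

lemma Pw_Suc: "Pw (Suc n) = ideal_prod (ring_of_integers K) (Pw n) P"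
  by (simp add: Pw_def nat_pow_def ideals_set_def)

lemma ideal_Pw: "ideal (Pw n) (ring_of_integers K)"
proof -
  interpret cring "ring_of_integers K" by (rule cring_OK)
  show ?thesis
  proof (induction n)
    case 0
    show ?case using oneideal by (simp add: Pw_0 carrier_ring_of_integers)
  next
    case (Suc n)
    show ?case unfolding Pw_Suc by (rule ideal_prod_is_ideal[OF Suc ideal_P])
  qed
qed

lemmas Pw_closed = ideal_closed[OF ideal_Pw]

lemma Pw_Suc_mult: "x \<in> Pw n \<Longrightarrow> y \<in> P \<Longrightarrow> x * y \<in> Pw (Suc n)"
  unfolding Pw_Suc using ideal_prod.prod[of x "Pw n" y P "ring_of_integers K"] by simp

lemma Pw_antimono: "m \<le> n \<Longrightarrow> Pw n \<subseteq> Pw m"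
proof (induction n rule: dec_induct)
  case (step n)
  interpret cring "ring_of_integers K" by (rule cring_OK)
  have "Pw (Suc n) \<subseteq> Pw n"
    unfolding Pw_Suc using ideal_prod_inter[OF ideal_Pw ideal_P] by blast
  thus ?case using step by blast
qed simp

lemma Pw_1: "Pw (Suc 0) = P"
proof -
  interpret cring "ring_of_integers K" by (rule cring_OK)
  show ?thesis
    using ideal_prod_inter[OF ideal_Pw[of 0] ideal_P] Pw_Suc_mult[of 1 0] Pw_Suc[of 0] OK_closed(2)
    by (auto simp: Pw_0)
qed

lemma power_in_Pw: "x \<in> P \<Longrightarrow> x ^ n \<in> Pw n"
  by (induction n) (auto simp: Pw_0 OK_closed mult.commute[of x] intro: Pw_Suc_mult)

text \<open>An element \<open>t\<close> outside \<open>P\<close> is invertible modulo every power of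
  \<open>P\<close>, not only modulo \<open>P\<close>.\<close>

lemma Pw_cancel:
  assumes x: "x \<in> OK" and t: "t \<in> OK - P" and tx: "t * x \<in> Pw n"
  shows "x \<in> Pw n"
proof -
  obtain y where y: "y \<in> OK" "1 - y * t \<in> P" using inverse_mod_P t by blast
  have "\<exists>r\<in>OK. 1 - r * t \<in> Pw n"
  proof (induction n)
    case 0
    show ?case using y P_closed(1) by (auto simp: Pw_0)
  next
    case (Suc n)
    then obtain r where r: "r \<in> OK" "1 - r * t \<in> Pw n" by blast
    \<comment> \<open>Lifting of the inverse: the product of the two errors lies in the next power
      of \<open>P\<close> and is again of the form \<open>1 - r' * t\<close>.\<close>
    have "(1 - r * t) * (1 - y * t) = 1 - (r + y - r * y * t) * t" by (simp add: algebra_simps)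
    moreover have "r + y - r * y * t \<in> OK" using r y t by (auto intro!: OK_closed)
    ultimately show ?case using Pw_Suc_mult[OF r(2) y(2)] by metis
  qed
  then obtain r where r: "r \<in> OK" "1 - r * t \<in> Pw n" by blast
  have "x * (1 - r * t) + r * (t * x) \<in> Pw n"
    using Pw_closed(3)[OF Pw_closed(4)[OF r(2) x] Pw_closed(4)[OF tx r(1)]] .
  thus ?thesis by (simp add: algebra_simps)
qed

text \<open>Locally \<open>P\<close> is generated by the uniformizer \<open>u\<close>, hence
  \<open>P^n\<close> by \<open>u^n\<close>; the factor \<open>t\<close> clears the denominator and
  can be cancelled modulo \<open>P^n\<close>.\<close>

lemma ex_Pw_characterization:
  obtains u where "u \<in> P" "u \<noteq> 0"
    "\<And>n a. a \<in> OK \<Longrightarrow> a \<in> Pw n \<longleftrightarrow> (\<exists>t\<in>OK - P. \<exists>c\<in>OK. t * a = u ^ n * c)"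
proof -
  obtain u s where us: "u \<in> P" "s \<in> OK - P" "\<And>x. x \<in> P \<Longrightarrow> \<exists>y\<in>OK. s * x = u * y"
    using ex_uniformizer by metis
  \<comment> \<open>The denominator \<open>s^n\<close> depends on \<open>n\<close> alone, which
    makes the case of sums in the ideal product immediate.\<close>
  have forward: "\<exists>c\<in>OK. s ^ n * a = u ^ n * c" if "a \<in> Pw n" for n a
    using that
  proof (induction n arbitrary: a)
    case 0
    thus ?case by (auto simp: Pw_0)
  next
    case (Suc n)
    from Suc.prems[unfolded Pw_Suc] show ?case
    proof (induction a rule: ideal_prod.induct)
      case (prod i j)
      obtain c y where "c \<in> OK" "s ^ n * i = u ^ n * c" "y \<in> OK" "s * j = u * y"
        using Suc.IH[OF prod(1)] us(3)[OF prod(2)] by blast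
      hence "(s ^ n * i) * (s * j) = (u ^ n * c) * (u * y)" "c * y \<in> OK"
        by (simp_all add: OK_closed)
      thus ?case by (intro bexI[of _ "c * y"]) (simp_all add: mult_ac)
    next
      case (sum a b)
      then obtain c d
        where "c \<in> OK" "s ^ Suc n * a = u ^ Suc n * c" "d \<in> OK" "s ^ Suc n * b = u ^ Suc n * d"
        by blast
      thus ?case by (intro bexI[of _ "c + d"]) (simp_all only: ring_of_integers_simps distrib_left OK_closed)
    qed
  qed
  have sn: "s ^ n \<in> OK - P" for n using us(2) P_power OK_closed(7) by blast
  show ?thesis
  proof (rule that)
    show "u \<noteq> 0"
    proof
      assume "u = 0"
      obtain a where a: "a \<in> P" "a \<noteq> 0" using P_neq_0 P_closed(2) by blast
      have "s \<noteq> 0" using us(2) P_closed(2) by auto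
      thus False using us(3)[OF a(1)] a(2) \<open>u = 0\<close> by auto
    qed
    fix n a assume a: "a \<in> OK"
    show "a \<in> Pw n \<longleftrightarrow> (\<exists>t\<in>OK - P. \<exists>c\<in>OK. t * a = u ^ n * c)"
    proof
      assume "a \<in> Pw n"
      thus "\<exists>t\<in>OK - P. \<exists>c\<in>OK. t * a = u ^ n * c" using forward sn by blast
    next
      assume "\<exists>t\<in>OK - P. \<exists>c\<in>OK. t * a = u ^ n * c"
      then obtain t c where tc: "t \<in> OK - P" "c \<in> OK" "t * a = u ^ n * c" by blast
      hence "t * a \<in> Pw n" using Pw_closed(5)[OF power_in_Pw[OF us(1)]] by simp
      thus "a \<in> Pw n" using Pw_cancel[OF a tc(1)] by blast
    qed
  qed (use us in auto)
qed

text \<open>The exact exponent is kept as a relation: as long as it is not known to exist, the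
  \<open>GREATEST\<close> in \<open>ideal_mult\<close> carries no information.\<close>

definition level :: "'a \<Rightarrow> nat \<Rightarrow> bool" where
  "level a n \<longleftrightarrow> a \<in> Pw n \<and> a \<notin> Pw (Suc n)"

lemma ideal_mult_level: "level a n \<Longrightarrow> ideal_mult K P a = n"
  unfolding ideal_mult_def level_def Pw_def[symmetric]
proof (rule Greatest_equality)
  fix m assume "a \<in> Pw n \<and> a \<notin> Pw (Suc n)" "a \<in> Pw m"
  thus "m \<le> n" using Pw_antimono[of "Suc n" m] by (meson not_less_eq_eq subsetD)
qed simp

lemma level_0_iff: "a \<in> OK \<Longrightarrow> level a 0 \<longleftrightarrow> a \<notin> P"
  using Pw_1 by (simp add: level_def Pw_0)

text \<open>Exact exponent \<open>m\<close> means \<open>u^m\<close> times a local unit: in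
  \<open>t * a = u^m * c\<close> the factor \<open>c\<close> lies outside \<open>P\<close> too. Such
  presentations multiply because \<open>P\<close> is prime.\<close>

lemma level_mult:
  assumes "level a m" "level b n"
  shows "level (a * b) (m + n)"
proof -
  obtain u where u: "u \<in> P" "u \<noteq> 0"
    "\<And>n a. a \<in> OK \<Longrightarrow> a \<in> Pw n \<longleftrightarrow> (\<exists>t\<in>OK - P. \<exists>c\<in>OK. t * a = u ^ n * c)"
    using ex_Pw_characterization by metis
  have ab: "a \<in> OK" "b \<in> OK" using assms Pw_closed(1) by (auto simp: level_def)
  have unit: "\<exists>t\<in>OK - P. \<exists>c\<in>OK - P. t * a = u ^ m * c" if a: "a \<in> OK" "level a m" for a m
  proof -
    obtain t c where tc: "t \<in> OK - P" "c \<in> OK" "t * a = u ^ m * c"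
      using u(3)[OF a(1)] a(2) unfolding level_def by blast
    have "c \<notin> P"
    proof
      assume "c \<in> P"
      hence "t * a \<in> Pw (Suc m)" using tc(3) Pw_Suc_mult[OF power_in_Pw[OF u(1)]] by simp
      hence "a \<in> Pw (Suc m)" using Pw_cancel[OF a(1) tc(1)] by blast
      thus False using a(2) by (simp add: level_def)
    qed
    thus ?thesis using tc by blast
  qed
  obtain t c where tc: "t \<in> OK - P" "c \<in> OK - P" "t * a = u ^ m * c"
    using unit[OF ab(1) assms(1)] by blast
  obtain t' c' where tc': "t' \<in> OK - P" "c' \<in> OK - P" "t' * b = u ^ n * c'"
    using unit[OF ab(2) assms(2)] by blast
  have eq: "(t * t') * (a * b) = u ^ (m + n) * (c * c')"
  proof -
    have "(t * t') * (a * b) = (t * a) * (t' * b)" by (simp add: mult_ac)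
    thus ?thesis unfolding tc(3) tc'(3) by (simp add: power_add mult_ac)
  qed
  have abO: "a * b \<in> OK" using ab OK_closed(6) by blast
  have "a * b \<in> Pw (m + n)"
    using u(3)[OF abO] eq compl_P_mult[OF tc(1) tc'(1)] compl_P_mult[OF tc(2) tc'(2)] by blast
  moreover have "a * b \<notin> Pw (Suc (m + n))"
  proof
    assume "a * b \<in> Pw (Suc (m + n))"
    then obtain s d where sd: "s \<in> OK - P" "d \<in> OK" "s * (a * b) = u ^ Suc (m + n) * d"
      using u(3)[OF abO] by blast
    have "u ^ (m + n) * (s * (c * c')) = s * ((t * t') * (a * b))"
      unfolding eq by (simp add: mult_ac)
    also have "\<dots> = (t * t') * (s * (a * b))" by (simp add: mult_ac)
    also have "\<dots> = u ^ (m + n) * (u * (d * (t * t')))" unfolding sd(3) by (simp add: mult_ac)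
    finally have "s * (c * c') = u * (d * (t * t'))" using u(2) by simp
    moreover have "u * (d * (t * t')) \<in> P"
      using sd(2) tc(1) tc'(1) by (intro P_closed(5)[OF u(1)] OK_closed) auto
    moreover have "s * (c * c') \<notin> P"
      using compl_P_mult[OF sd(1) compl_P_mult[OF tc(2) tc'(2)]] by blast
    ultimately show False by simp
  qed
  ultimately show ?thesis by (simp add: level_def)
qed

text \<open>If \<open>q\<close> had order greater than \<open>N\<close>, the powers \<open>1, u, \<dots>, u^N\<close> of a uniformizer would be
  linearly independent over \<open>\<rat>\<close>.\<close>

lemma ex_q_notin_Pw: "\<exists>n. of_nat q \<notin> Pw n"
proof -
  obtain u where u: "u \<in> P" "u \<noteq> 0"
    "\<And>n a. a \<in> OK \<Longrightarrow> a \<in> Pw n \<longleftrightarrow> (\<exists>t\<in>OK - P. \<exists>c\<in>OK. t * a = u ^ n * c)"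
    using ex_Pw_characterization by metis
  have uO: "u \<in> OK" using u P_closed(1) by blast
  obtain N where N: "\<And>f (q::nat). q > 1 \<Longrightarrow> (\<And>i. i \<le> N \<Longrightarrow> f i \<in> K) \<Longrightarrow>
    \<exists>c::nat \<Rightarrow> int. (\<exists>i\<le>N. \<not> int q dvd c i) \<and> (\<Sum>i\<le>N. of_int (c i) * f i) = 0"
    using int_dependence by metis
  have "of_nat q \<notin> Pw (Suc N)"
  proof
    assume "of_nat q \<in> Pw (Suc N)"
    then obtain t d where td: "t \<in> OK - P" "d \<in> OK" "t * of_nat q = u ^ Suc N * d"
      using u(3)[of "of_nat q" "Suc N"] OK_closed(10) by blast
    have "u ^ i \<in> K" for i using uO OK_subset K_closed(7) by blast
    with N[of q "\<lambda>i. u ^ i"] obtain c :: "nat \<Rightarrow> int"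
      where c: "\<exists>i\<le>N. \<not> int q dvd c i" "(\<Sum>i\<le>N. of_int (c i) * u ^ i) = 0"
      using prime_gt_1_nat[OF prime_q] by auto
    \<comment> \<open>Modulo a factor outside \<open>P\<close>, the terms with \<open>i < m\<close>
      are divisible by \<open>q\<close>, hence by \<open>u^(N + 1)\<close>, and those with
      \<open>i > m\<close> by \<open>u^(m + 1)\<close>. After cancelling \<open>u^m\<close> only the
      \<open>m\<close>-th coefficient survives modulo \<open>P\<close>.\<close>
    define m where "m = (LEAST i. i \<le> N \<and> \<not> int q dvd c i)"
    have m: "m \<le> N" "\<not> int q dvd c m" using LeastI_ex[OF c(1)] by (auto simp: m_def)
    have lt: "int q dvd c i" if "i < m" for i
      using not_less_Least[of i "\<lambda>i. i \<le> N \<and> \<not> int q dvd c i"] that m(1)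
        by (auto simp: m_def)
    have "\<exists>y\<in>OK. t * (of_int (c i) * u ^ i) = u ^ m * (u * y)" if i: "i \<le> N" "i \<noteq> m" for i
    proof (cases "i < m")
      case True
      then obtain l where l: "c i = int q * l" using lt by blast
      have "Suc N = m + Suc (N - m)" using m by simp
      hence N: "u ^ Suc N = u ^ m * (u * u ^ (N - m))" by (metis power_Suc power_add)
      have "t * (of_int (c i) * u ^ i) = (t * of_nat q) * (of_int l * u ^ i)"
        by (simp add: l mult_ac)
      also have "\<dots> = u ^ m * (u * (u ^ (N - m) * d * (of_int l * u ^ i)))"
        unfolding td(3) N by (simp add: mult_ac)
      finally show ?thesis
        using td(2) uO
          by (intro bexI[of _ "u ^ (N - m) * d * (of_int l * u ^ i)"]) (auto intro!: OK_closed)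
    next
      case False
      hence "i = m + Suc (i - Suc m)" using i by simp
      hence "u ^ i = u ^ m * (u * u ^ (i - Suc m))" by (metis power_Suc power_add)
      hence "t * (of_int (c i) * u ^ i) = u ^ m * (u * (t * of_int (c i) * u ^ (i - Suc m)))"
        by (simp add: mult_ac)
      thus ?thesis
        using td(1) uO
          by (intro bexI[of _ "t * of_int (c i) * u ^ (i - Suc m)"]) (auto intro!: OK_closed)
    qed
    then obtain y
      where y: "\<And>i. i \<le> N \<Longrightarrow> i \<noteq> m \<Longrightarrow> y i \<in> OK \<and> t * (of_int (c i) * u ^ i) = u ^ m * (u * y i)"
      by metis
    define Y where "Y = (\<Sum>i\<in>{..N} - {m}. y i)"
    have YO: "Y \<in> OK" unfolding Y_def using y by (intro OK_closed(8)) auto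
    have "0 = t * (\<Sum>i\<le>N. of_int (c i) * u ^ i)" using c(2) by simp
    also have "\<dots> = (\<Sum>i\<le>N. t * (of_int (c i) * u ^ i))" by (rule sum_distrib_left)
    also have "\<dots> = t * (of_int (c m) * u ^ m) + (\<Sum>i\<in>{..N} - {m}. t * (of_int (c i) * u ^ i))"
      using m(1) by (intro sum.remove) auto
    also have "(\<Sum>i\<in>{..N} - {m}. t * (of_int (c i) * u ^ i)) = (\<Sum>i\<in>{..N} - {m}. u ^ m * (u * y i))"
      using y by (intro sum.cong) auto
    also have "\<dots> = u ^ m * (u * Y)" by (simp add: Y_def sum_distrib_left)
    finally have "u ^ m * (t * of_int (c m) + u * Y) = 0" by (simp add: algebra_simps)
    hence "t * of_int (c m) = - (u * Y)" using u(2) by (simp add: eq_neg_iff_add_eq_0)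
    hence "t * of_int (c m) \<in> P" using P_closed(5)[OF u(1) YO] P_closed(6) by simp
    hence "of_int (c m) \<in> P" using P_prime[of t "of_int (c m)"] td(1) OK_closed(9) by blast
    thus False using of_int_in_P_iff[OF prime_q q_in_P] m(2) by blast
  qed
  thus ?thesis by blast
qed

lemma level_exI:
  assumes "a \<in> OK" "a \<notin> Pw n"
  shows "\<exists>m. level a m"
proof -
  define k where "k = (LEAST k. a \<notin> Pw k)"
  have k: "a \<notin> Pw k" unfolding k_def using assms(2) by (rule LeastI)
  then obtain m where m: "k = Suc m" using assms(1) Pw_0 by (cases k) auto
  have "a \<in> Pw m"
    using not_less_Least[of m "\<lambda>k. a \<notin> Pw k"] m unfolding k_def by auto
  thus ?thesis using k m unfolding level_def by blast
qed

text \<open>Splitting off factors \<open>q\<close>, whose exponent is finite, leaves an integer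
  prime to \<open>q\<close>, which lies outside \<open>P\<close>.\<close>

lemma level_of_int: "k \<noteq> 0 \<Longrightarrow> \<exists>m. level (of_int k) m"
proof (induction "nat \<bar>k\<bar>" arbitrary: k rule: less_induct)
  case less
  show ?case
  proof (cases "int q dvd k")
    case False
    thus ?thesis using level_0_iff of_int_in_P_iff[OF prime_q q_in_P] OK_closed(9) by blast
  next
    case True
    then obtain l where l: "k = int q * l" by blast
    have "nat \<bar>l\<bar> < nat \<bar>k\<bar>"
      using less.prems prime_gt_1_nat[OF prime_q] by (auto simp: l abs_mult nat_mult_distrib)
    moreover have "l \<noteq> 0" using less.prems l by auto
    ultimately obtain m where "level (of_int l) m" using less.hyps by blast
    moreover obtain n where "level (of_nat q) n"
      using ex_q_notin_Pw level_exI OK_closed(10) by blast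
    ultimately show ?thesis using level_mult[of "of_nat q" n "of_int l" m] by (auto simp: l)
  qed
qed

text \<open>\<open>a\<close> divides a nonzero rational integer of finite exponent, so it cannot lie
  in all powers of \<open>P\<close>.\<close>

lemma level_ex:
  assumes a: "a \<in> OK" "a \<noteq> 0"
  shows "\<exists>m. level a m"
proof -
  obtain k :: int and b where k: "k \<noteq> 0" "b \<in> OK" "of_int k = a * b"
    using integer_multiple_nonzero[OF a] by metis
  obtain m where "level (of_int k) m" using level_of_int[OF k(1)] by blast
  hence "a \<notin> Pw (Suc m)" using k Pw_closed(5)[of a "Suc m" b] unfolding level_def by auto
  thus ?thesis using level_exI a by blast
qed

lemma level_ideal_mult: "a \<in> OK \<Longrightarrow> a \<noteq> 0 \<Longrightarrow> level a (ideal_mult K P a)"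
  using level_ex ideal_mult_level by blast

lemma ideal_mult_mult:
  assumes "a \<in> OK" "a \<noteq> 0" "b \<in> OK" "b \<noteq> 0"
  shows "ideal_mult K P (a * b) = ideal_mult K P a + ideal_mult K P b"
  using ideal_mult_level level_mult level_ideal_mult assms by blast

lemma ideal_mult_ge_iff:
  assumes "a \<in> OK" "a \<noteq> 0"
  shows "n \<le> ideal_mult K P a \<longleftrightarrow> a \<in> Pw n"
  using level_ideal_mult[OF assms] Pw_antimono[of n "ideal_mult K P a"] Pw_antimono[of "Suc (ideal_mult K P a)" n]
  unfolding level_def by (meson not_less_eq_eq subsetD)

section \<open>The order at a prime on the whole field\<close>

abbreviation ord :: "'a \<Rightarrow> int" where "ord \<equiv> prime_ord K P"

lemma ord_fraction:
  assumes "a \<in> OK" "a \<noteq> 0" "b \<in> OK" "b \<noteq> 0"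
  shows "ord (a / b) = int (ideal_mult K P a) - int (ideal_mult K P b)"
  unfolding prime_ord_def carrier_ring_of_integers
proof (rule the_equality)
  show "\<exists>a'\<in>OK - {0}. \<exists>b'\<in>OK - {0}. a / b = a' / b' \<and>
      int (ideal_mult K P a) - int (ideal_mult K P b) = int (ideal_mult K P a') - int (ideal_mult K P b')"
    using assms by blast
next
  fix k assume "\<exists>a'\<in>OK - {0}. \<exists>b'\<in>OK - {0}. a / b = a' / b' \<and>
      k = int (ideal_mult K P a') - int (ideal_mult K P b')"
  then obtain a' b'
    where *: "a' \<in> OK" "a' \<noteq> 0" "b' \<in> OK" "b' \<noteq> 0" "a / b = a' / b'"
      "k = int (ideal_mult K P a') - int (ideal_mult K P b')" by blast
  have "a * b' = a' * b" using *(4,5) assms(4) by (simp add: field_simps)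
  hence "ideal_mult K P a + ideal_mult K P b' = ideal_mult K P a' + ideal_mult K P b"
    using ideal_mult_mult * assms by metis
  thus "k = int (ideal_mult K P a) - int (ideal_mult K P b)" using *(6) by linarith
qed

lemma ord_integral:
  assumes "a \<in> OK" "a \<noteq> 0"
  shows "ord a = int (ideal_mult K P a)"
proof -
  have "ideal_mult K P 1 = 0"
    using ideal_mult_level level_0_iff[of 1] OK_closed(2) one_notin_P by blast
  thus ?thesis using ord_fraction[OF assms, of 1] OK_closed(2) by simp
qed

lemma ord_ge_iff: "a \<in> OK \<Longrightarrow> a \<noteq> 0 \<Longrightarrow> int n \<le> ord a \<longleftrightarrow> a \<in> Pw n"
  using ord_integral ideal_mult_ge_iff by simp

lemma ord_pos_iff: "a \<in> OK \<Longrightarrow> a \<noteq> 0 \<Longrightarrow> 0 < ord a \<longleftrightarrow> a \<in> P"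
  using ord_ge_iff[of a 1] Pw_1 by (simp add: int_one_le_iff_zero_less)

lemma ord_eq_0_iff: "a \<in> OK \<Longrightarrow> a \<noteq> 0 \<Longrightarrow> ord a = 0 \<longleftrightarrow> a \<notin> P"
  using ord_pos_iff[of a] ord_integral[of a] by auto

lemma K_fraction:
  assumes "x \<in> K"
  obtains a b where "a \<in> OK" "b \<in> OK" "b \<noteq> 0" "x = a / b"
proof -
  obtain d :: int where d: "d \<noteq> 0" "of_int d * x \<in> OK"
    using int_multiple_integral[OF assms] .
  show ?thesis by (rule that[OF d(2) OK_closed(9)[of d]]) (use d(1) in auto)
qed

lemma ord_mult:
  assumes "x \<in> K" "x \<noteq> 0" "y \<in> K" "y \<noteq> 0"
  shows "ord (x * y) = ord x + ord y"
proof -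
  obtain a b where ab: "a \<in> OK" "b \<in> OK" "b \<noteq> 0" "x = a / b"
    using K_fraction[OF assms(1)] .
  obtain c d where cd: "c \<in> OK" "d \<in> OK" "d \<noteq> 0" "y = c / d"
    using K_fraction[OF assms(3)] .
  have nz: "a \<noteq> 0" "c \<noteq> 0" using ab cd assms by auto
  have "ord (x * y) = ord ((a * c) / (b * d))" by (simp add: ab cd)
  also have "\<dots> = ord x + ord y"
    using ab cd nz by (simp add: ord_fraction ideal_mult_mult OK_closed)
  finally show ?thesis .
qed

lemma ord_add:
  assumes "x \<in> K" "x \<noteq> 0" "y \<in> K" "y \<noteq> 0" "x + y \<noteq> 0"
  shows "min (ord x) (ord y) \<le> ord (x + y)"
proof -
  obtain a b where ab: "a \<in> OK" "b \<in> OK" "b \<noteq> 0" "x = a / b"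
    using K_fraction[OF assms(1)] .
  obtain c d where cd: "c \<in> OK" "d \<in> OK" "d \<noteq> 0" "y = c / d"
    using K_fraction[OF assms(3)] .
  have nz: "a \<noteq> 0" "c \<noteq> 0" using ab cd assms by auto
  define A B where "A = a * d" and "B = c * b"
  have AB: "A \<in> OK" "B \<in> OK" "A \<noteq> 0" "B \<noteq> 0" and bd: "b * d \<in> OK" "b * d \<noteq> 0"
    using ab cd nz by (auto simp: A_def B_def OK_closed)
  have eq: "x = A / (b * d)" "y = B / (b * d)" "x + y = (A + B) / (b * d)"
    using ab cd by (auto simp: A_def B_def field_simps)
  have ABn: "A + B \<in> OK" "A + B \<noteq> 0" using AB eq assms(5) by (auto simp: OK_closed)
  define n where "n = min (ideal_mult K P A) (ideal_mult K P B)"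
  have "A \<in> Pw n" "B \<in> Pw n"
    using ideal_mult_ge_iff[OF AB(1,3), of n] ideal_mult_ge_iff[OF AB(2,4), of n]
      by (auto simp: n_def)
  hence "n \<le> ideal_mult K P (A + B)" using ideal_mult_ge_iff[OF ABn] Pw_closed(3) by blast
  thus ?thesis unfolding eq(3) unfolding eq(1,2)
    using AB ABn bd by (simp add: ord_fraction n_def)
qed

lemma ord_minus: "x \<in> K \<Longrightarrow> x \<noteq> 0 \<Longrightarrow> ord (- x) = ord x"
proof -
  assume x: "x \<in> K" "x \<noteq> 0"
  have "(- 1::'a) \<in> OK" "- 1 \<notin> P"
    using OK_closed(2,3) P_closed(6)[of "- 1"] one_notin_P by auto
  hence "ord (- 1) = 0" using ord_eq_0_iff by simp
  thus ?thesis using ord_mult[of "- 1" x] x K_closed(2,3) by simp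
qed

lemma ord_q_pos: "0 < ord (of_nat q)"
  using ord_pos_iff[of "of_nat q"] q_in_P OK_closed(10) prime_gt_0_nat[OF prime_q] by simp

abbreviation val :: "'a \<Rightarrow> rat" where "val \<equiv> prime_val K P"

lemma val_eq: "val x = of_int (ord x) / of_int (ord (of_nat q))"
  by (simp add: prime_val_def q_def)

lemma val_mult:
  assumes "x \<in> K" "x \<noteq> 0" "y \<in> K" "y \<noteq> 0"
  shows "val (x * y) = val x + val y"
  using ord_mult[OF assms] by (simp add: val_eq add_divide_distrib)

lemma val_nonneg: "a \<in> OK \<Longrightarrow> a \<noteq> 0 \<Longrightarrow> 0 \<le> val a"
  using ord_integral[of a] ord_q_pos by (simp add: val_eq)

lemma val_pos: "a \<in> P \<Longrightarrow> a \<noteq> 0 \<Longrightarrow> 0 < val a"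
  using ord_pos_iff[of a] P_closed(1) ord_q_pos by (auto simp: val_eq)

lemma val_eq_0: "a \<in> OK \<Longrightarrow> a \<notin> P \<Longrightarrow> val a = 0"
  using ord_eq_0_iff[of a] P_closed(2) by (auto simp: val_eq)

end

section \<open>Several primes and primes above\<close>

context num_field
begin

lemma num_field_primeI: "Q \<in> nonzero_primes K \<Longrightarrow> num_field_prime K Q"
  by unfold_locales

lemma nonzero_primes_subset_imp_eq:
  assumes "Q \<in> nonzero_primes K" "R \<in> nonzero_primes K" "Q \<subseteq> R"
  shows "Q = R"
proof (rule ccontr)
  interpret Q: num_field_prime K Q using assms(1) by (rule num_field_primeI)
  interpret R: num_field_prime K R using assms(2) by (rule num_field_primeI)
  assume "Q \<noteq> R"
  then obtain x where x: "x \<in> R" "x \<notin> Q" using assms(3) by blast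
  have xO: "x \<in> OK" using x(1) R.P_closed(1) by blast
  obtain y where y: "y \<in> OK" "1 - y * x \<in> Q" using Q.inverse_mod_P[OF xO x(2)] .
  have "1 - y * x + y * x \<in> R" using y assms(3) R.P_closed(3,4) x(1) by blast
  thus False using R.one_notin_P by simp
qed

lemma nonzero_primes_comaximal:
  assumes "Q \<in> nonzero_primes K" "R \<in> nonzero_primes K" "Q \<noteq> R"
  obtains a where "a \<in> Q" "1 - a \<in> R"
proof -
  interpret Q: num_field_prime K Q using assms(1) by (rule num_field_primeI)
  interpret R: num_field_prime K R using assms(2) by (rule num_field_primeI)
  obtain x where x: "x \<in> Q" "x \<notin> R"
    using nonzero_primes_subset_imp_eq[OF assms(1,2)] assms(3) by blast
  have xO: "x \<in> OK" using x(1) Q.P_closed(1) by blast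
  obtain y where y: "y \<in> OK" "1 - y * x \<in> R" using R.inverse_mod_P[OF xO x(2)] .
  show ?thesis by (rule that[OF _ y(2)]) (use Q.P_closed(4)[OF x(1) y(1)] in simp)
qed

lemma separate_prime:
  assumes "finite S" "S \<subseteq> nonzero_primes K" "Q \<in> nonzero_primes K" "Q \<notin> S"
  obtains w where "w \<in> Q" "\<forall>R\<in>S. 1 - w \<in> R"
proof -
  interpret Q: num_field_prime K Q using assms(3) by (rule num_field_primeI)
  have "\<exists>w\<in>Q. \<forall>R\<in>S. 1 - w \<in> R"
    using assms(1,2,4)
  proof (induction S rule: finite_induct)
    case empty
    show ?case using Q.P_closed(2) by blast
  next
    case (insert R S)
    then obtain w where w: "w \<in> Q" "\<forall>R\<in>S. 1 - w \<in> R" by auto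
    obtain a where a: "a \<in> Q" "1 - a \<in> R"
      using nonzero_primes_comaximal[of Q R] assms(3) insert.prems by auto
    have O: "w \<in> OK" "a \<in> OK" "1 - w \<in> OK" "1 - a \<in> OK"
      using w(1) a(1) Q.P_closed(1) OK_closed(2,5) by auto
    \<comment> \<open>The combination \<open>w + a - w * a\<close> stays in \<open>Q\<close>, and
      its complement to 1 is a product, hence lies in \<open>R\<close> and in all earlier primes at
      once.\<close>
    have eq: "1 - (w + a - w * a) = (1 - w) * (1 - a)" by (simp add: algebra_simps)
    have "w + a - w * a \<in> Q" using w a O Q.P_closed(3,5,7) by blast
    moreover have "(1 - w) * (1 - a) \<in> R'" if R': "R' \<in> insert R S" for R'
    proof -
      interpret R': num_field_prime K R' using insert.prems R' by (intro num_field_primeI) auto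
      show ?thesis using R' w(2) a(2) O R'.P_closed(4,5) by blast
    qed
    ultimately show ?case using eq by metis
  qed
  thus ?thesis using that by blast
qed

text \<open>Elements \<open>e i\<close> with \<open>e i \<equiv> 1\<close> modulo the \<open>i\<close>-th prime and \<open>e i \<equiv> 0\<close> modulo the others are
  linearly independent over \<open>\<rat>\<close>, so there are at most as many primes over \<open>q\<close> as the degree.\<close>

lemma finite_primes_over:
  assumes q: "Factorial_Ring.prime (q::nat)"
  shows "finite {Q \<in> nonzero_primes K. lies_over_rational Q q}" (is "finite ?S")
proof (rule ccontr)
  assume inf: "infinite ?S"
  obtain N where N: "\<And>f (q::nat). q > 1 \<Longrightarrow> (\<And>i. i \<le> N \<Longrightarrow> f i \<in> K) \<Longrightarrow>
    \<exists>c::nat \<Rightarrow> int. (\<exists>i\<le>N. \<not> int q dvd c i) \<and> (\<Sum>i\<le>N. of_int (c i) * f i) = 0"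
    using int_dependence by metis
  obtain Q :: "nat \<Rightarrow> 'a set" where Q: "inj Q" "range Q \<subseteq> ?S"
    using infinite_countable_subset[OF inf] by blast
  have Qp: "Q i \<in> nonzero_primes K" for i using Q(2) by blast
  have "\<exists>w. w \<in> Q i \<and> (\<forall>j\<in>{..N} - {i}. 1 - w \<in> Q j)" for i
  proof -
    have "Q i \<notin> Q ` ({..N} - {i})" using Q(1) by (auto dest: injD)
    moreover have "finite (Q ` ({..N} - {i}))" "Q ` ({..N} - {i}) \<subseteq> nonzero_primes K"
      using Qp by auto
    ultimately obtain w where "w \<in> Q i" "\<forall>R\<in>Q ` ({..N} - {i}). 1 - w \<in> R"
      using separate_prime[OF _ _ Qp[of i]] by metis
    thus ?thesis by blast
  qed
  then obtain w
    where w: "\<And>i. w i \<in> Q i" "\<And>i j. j \<le> N \<Longrightarrow> j \<noteq> i \<Longrightarrow> 1 - w i \<in> Q j"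
    by (metis DiffI atMost_iff singletonD)
  have wO: "w i \<in> OK" for i
  proof -
    interpret num_field_prime K "Q i" by (rule num_field_primeI[OF Qp])
    show ?thesis using w(1) P_closed(1) by blast
  qed
  have wO': "1 - w i \<in> OK" for i using wO OK_closed(2,5) by blast
  hence "1 - w i \<in> K" for i using OK_subset by blast
  with N[of q "\<lambda>i. 1 - w i"] obtain c :: "nat \<Rightarrow> int"
    where c: "\<exists>i\<le>N. \<not> int q dvd c i" "(\<Sum>i\<le>N. of_int (c i) * (1 - w i)) = 0"
    using prime_gt_1_nat[OF q] by auto
  then obtain m where m: "m \<le> N" "\<not> int q dvd c m" by blast
  interpret Qm: num_field_prime K "Q m" by (rule num_field_primeI[OF Qp])
  have sum_Qm: "(\<Sum>i\<in>A. of_int (c i) * (1 - w i)) \<in> Q m" if "A \<subseteq> {..N} - {m}" for A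
    using finite_subset[OF that] that
  proof (induction A rule: infinite_finite_induct)
    case (insert i A)
    have "of_int (c i) * (1 - w i) \<in> Q m"
      using insert.prems w(2)[of m i] m(1) OK_closed(9) by (intro Qm.P_closed(4)) auto
    thus ?case using insert by (simp add: Qm.P_closed(3))
  qed (auto simp: Qm.P_closed(2))
  \<comment> \<open>Modulo \<open>Q m\<close> the factor \<open>1 - w m\<close> is 1 and the others
    are 0, so the relation reduces to \<open>c m \<in> Q m\<close>, that is, to \<open>q\<close>
    dividing \<open>c m\<close>.\<close>
  have "0 = of_int (c m) * (1 - w m) + (\<Sum>i\<in>{..N} - {m}. of_int (c i) * (1 - w i))"
    unfolding c(2)[symmetric] using m(1) by (intro sum.remove) auto
  hence "of_int (c m) = of_int (c m) * w m - (\<Sum>i\<in>{..N} - {m}. of_int (c i) * (1 - w i))"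
    by (simp add: algebra_simps)
  also have "\<dots> \<in> Q m"
    using sum_Qm[of "{..N} - {m}"] w(1)[of m] OK_closed(9)
      by (intro Qm.P_closed(7) Qm.P_closed(4)) auto
  finally have "of_int (c m) \<in> Q m" .
  moreover have "of_nat q \<in> Q m" using Qm.lies_over_rational_iff[OF q] Q(2) by blast
  ultimately show False using Qm.of_int_in_P_iff[OF q] m(2) by blast
qed

end

section \<open>Primes of an extension and their contractions\<close>

lemma to_ac_poly_of_int:
  "poly (map_poly of_int p) (to_ac x) = to_ac (poly (map_poly of_int p) (x::'a::field_char_0))"
  by (induction p) (simp_all add: map_poly_pCons)

lemma algebraic_int_to_ac_iff [simp]: "algebraic_int (to_ac x) \<longleftrightarrow> algebraic_int (x::'a::field_char_0)"
  unfolding algebraic_int_altdef_ipoly to_ac_poly_of_int by simp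

locale num_field_extension =
  K: num_field K + L: num_field L for K :: "'a::field_char_0 set" and L :: "'a alg_closure set" +
  assumes to_ac_K: "to_ac ` K \<subseteq> L"
begin

lemma to_ac_OK: "x \<in> K.OK \<Longrightarrow> to_ac x \<in> L.OK"
  using to_ac_K by (auto simp: K.OK_def L.OK_def)

text \<open>The contraction cannot exceed \<open>P\<close>: an element outside \<open>P\<close> is
  invertible modulo \<open>P\<close>, which would put 1 into \<open>Q\<close>.\<close>

lemma contraction_eq:
  assumes P: "P \<in> nonzero_primes K" and Q: "Q \<in> nonzero_primes L" and PQ: "to_ac ` P \<subseteq> Q"
  shows "to_ac -` Q \<inter> K.OK = P"
proof (intro equalityI subsetI)
  interpret P: num_field_prime K P by (rule K.num_field_primeI[OF P])
  interpret Q: num_field_prime L Q by (rule L.num_field_primeI[OF Q])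
  fix x assume x: "x \<in> to_ac -` Q \<inter> K.OK"
  show "x \<in> P"
  proof (rule ccontr)
    assume "x \<notin> P"
    then obtain y where y: "y \<in> K.OK" "1 - y * x \<in> P" using P.inverse_mod_P x by blast
    have "to_ac (1 - y * x) \<in> Q" using y(2) PQ by blast
    moreover have "to_ac y * to_ac x \<in> Q"
      using x to_ac_OK[OF y(1)] by (intro Q.P_closed(4)) auto
    ultimately have "to_ac (1 - y * x) + to_ac y * to_ac x \<in> Q" by (rule Q.P_closed(3))
    thus False using Q.one_notin_P by simp
  qed
next
  interpret P: num_field_prime K P by (rule K.num_field_primeI[OF P])
  fix x assume "x \<in> P"
  thus "x \<in> to_ac -` Q \<inter> K.OK" using PQ P.P_closed(1) by blast
qed

text \<open>If \<open>g P \<subseteq> OK\<close> with \<open>g \<notin> OK\<close>, then \<open>{x. g x \<in> OL}\<close> is a proper ideal of \<open>OL\<close> that contains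
  \<open>P\<close>; it is enlarged to a maximal one by counting residues modulo \<open>q\<close>.\<close>

lemma ex_prime_above:
  assumes P: "P \<in> nonzero_primes K"
  obtains Q where "Q \<in> nonzero_primes L" "to_ac ` P \<subseteq> Q"
proof -
  interpret P: num_field_prime K P by (rule K.num_field_primeI[OF P])
  interpret O: cring "ring_of_integers L" by (rule L.cring_OK)
  have O_carrier: "carrier (ring_of_integers L) = L.OK" by (rule L.carrier_ring_of_integers)
  obtain g where g: "g \<in> K" "g \<notin> K.OK" "\<And>x. x \<in> P \<Longrightarrow> g * x \<in> K.OK"
    using P.ex_inverse_element by metis
  obtain F where F: "finite F" "F \<subseteq> L.OK" "\<And>x. x \<in> L.OK \<Longrightarrow> \<exists>y\<in>F. \<exists>z\<in>L.OK. x = y + of_nat P.q * z"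
    using L.finite_representatives_mod[OF P.prime_q] by metis
  define J where "J = {x \<in> L.OK. to_ac g * x \<in> L.OK}"
  have J_ideal: "ideal J (ring_of_integers L)"
  proof (rule idealI[OF O.ring_axioms])
    show "subgroup J (add_monoid (ring_of_integers L))"
    proof (rule O.add.subgroupI)
      show "J \<subseteq> carrier (ring_of_integers L)" by (auto simp: J_def O_carrier)
      show "J \<noteq> {}" using L.OK_closed(1) by (auto simp: J_def)
      fix a assume a: "a \<in> J"
      have "\<ominus>\<^bsub>ring_of_integers L\<^esub> a = - a"
        using a L.OK_closed(3)
        by (intro O.minus_equality) (auto simp: J_def L.OK_def)
      thus "\<ominus>\<^bsub>ring_of_integers L\<^esub> a \<in> J"
        using a L.OK_closed(3) by (auto simp: J_def)
    next
      fix a b assume "a \<in> J" "b \<in> J"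
      thus "a \<oplus>\<^bsub>ring_of_integers L\<^esub> b \<in> J"
        by (auto simp: J_def distrib_left L.OK_closed)
    qed
  next
    fix a x assume ax: "a \<in> J" "x \<in> carrier (ring_of_integers L)"
    have "a * x \<in> L.OK" "to_ac g * a * x \<in> L.OK"
      using ax L.OK_closed(6) by (auto simp: J_def O_carrier simp del: ring_of_integers_simps(1))
    thus "x \<otimes>\<^bsub>ring_of_integers L\<^esub> a \<in> J" "a \<otimes>\<^bsub>ring_of_integers L\<^esub> x \<in> J"
      by (auto simp: J_def mult_ac)
  qed
  have J_P: "to_ac ` P \<subseteq> J"
    using P.P_closed(1) to_ac_OK g(3) by (auto simp: J_def simp flip: to_ac_mult)
  have J_1: "1 \<notin> J"
  proof
    assume "1 \<in> J"
    hence "algebraic_int (to_ac g)" by (simp add: J_def L.OK_def)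
    thus False using g(1,2) by (simp add: K.OK_def)
  qed
  \<comment> \<open>An ideal containing \<open>q\<close> is determined by the representatives in
    \<open>F\<close> that it contains, so a good ideal with the largest number of them is
    maximal.\<close>
  define good where "good I \<longleftrightarrow> ideal I (ring_of_integers L) \<and> J \<subseteq> I \<and> 1 \<notin> I" for I
  have "good J" using J_ideal J_1 by (simp add: good_def)
  moreover have "\<forall>I. good I \<longrightarrow> card (I \<inter> F) < Suc (card F)"
    using F(1) by (simp add: card_mono less_Suc_eq_le)
  ultimately obtain Q
    where Q: "good Q" "\<And>I. good I \<Longrightarrow> card (I \<inter> F) \<le> card (Q \<inter> F)"
    using ex_has_greatest_nat[of good J "\<lambda>I. card (I \<inter> F)" "Suc (card F)"] by blast
  have Q_ideal: "ideal Q (ring_of_integers L)" and JQ: "J \<subseteq> Q" and Q1: "1 \<notin> Q"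
    using Q(1) by (auto simp: good_def)
  have qJ: "of_nat P.q \<in> J" using J_P P.q_in_P by force
  have "maximalideal Q (ring_of_integers L)"
  proof (rule maximalidealI[OF Q_ideal])
    show "carrier (ring_of_integers L) \<noteq> Q" using Q1 L.OK_closed(2) O_carrier by auto
    fix I assume I: "ideal I (ring_of_integers L)" "Q \<subseteq> I" "I \<subseteq> carrier (ring_of_integers L)"
    interpret I: ideal I "ring_of_integers L" by (rule I(1))
    interpret Q: ideal Q "ring_of_integers L" by (rule Q_ideal)
    show "I = Q \<or> I = carrier (ring_of_integers L)"
    proof (cases "1 \<in> I")
      case True
      thus ?thesis using I.one_imp_carrier by simp
    next
      case False
      hence "good I" using I JQ by (auto simp: good_def)
      hence "card (I \<inter> F) \<le> card (Q \<inter> F)" by (rule Q(2))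
      moreover have "Q \<inter> F \<subseteq> I \<inter> F" using I(2) by blast
      ultimately have QF: "Q \<inter> F = I \<inter> F" using F(1) by (intro card_seteq) auto
      have "I \<subseteq> Q"
      proof
        fix x assume x: "x \<in> I"
        hence "x \<in> L.OK" using I(3) O_carrier by blast
        then obtain y z where yz: "y \<in> F" "z \<in> L.OK" "x = y + of_nat P.q * z"
          using F(3) by blast
        have qz: "of_nat P.q * z \<in> Q"
          using Q.I_r_closed[of "of_nat P.q" z] qJ JQ yz(2) by (auto simp: L.OK_def)
        hence "- (of_nat P.q * z) \<in> Q"
          using Q.I_l_closed[of "of_nat P.q * z" "- 1"] L.OK_closed(3)[OF L.OK_closed(2)]
            by (simp add: L.OK_def)
        hence "x + - (of_nat P.q * z) \<in> I"
          using additive_subgroup.a_closed[OF I.additive_subgroup_axioms, of x "- (of_nat P.q * z)"] x I(2) by auto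
        hence "y \<in> Q" using yz QF by auto
        thus "x \<in> Q"
          using additive_subgroup.a_closed[OF Q.additive_subgroup_axioms, of y "of_nat P.q * z"] qz yz(3) by simp
      qed
      thus ?thesis using I(2) by blast
    qed
  qed
  hence "primeideal Q (ring_of_integers L)" by (rule O.maximalideal_prime)
  moreover have "Q \<noteq> {0}" using qJ JQ prime_gt_0_nat[OF P.prime_q] by auto
  ultimately have "Q \<in> nonzero_primes L" by (simp add: nonzero_primes_def)
  moreover have "to_ac ` P \<subseteq> Q" using J_P JQ by blast
  ultimately show ?thesis by (rule that)
qed

lemma contraction_prime_below:
  assumes T: "P \<in> nonzero_primes K" and Q: "Q \<in> nonzero_primes L" and QP: "to_ac -` Q \<inter> K.OK = P"
  shows "prime_below Q = prime_below P"
proof -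
  interpret P: num_field_prime K P by (rule K.num_field_primeI[OF T])
  interpret Q: num_field_prime L Q by (rule L.num_field_primeI[OF Q])
  have "to_ac (of_nat P.q) \<in> Q" using QP P.q_in_P by blast
  thus ?thesis using Q.prime_below_eq[OF P.prime_q] by (simp add: P.q_def)
qed

lemma finite_primes_above:
  assumes T: "finite T" "T \<subseteq> nonzero_primes K"
  shows "finite (primes_above K T L)"
proof (rule finite_subset)
  show "primes_above K T L \<subseteq> (\<Union>P\<in>T. {Q \<in> nonzero_primes L. lies_over_rational Q (prime_below P)})"
  proof
    fix Q assume Q: "Q \<in> primes_above K T L"
    define P where "P = to_ac -` Q \<inter> K.OK"
    have P: "P \<in> T" "Q \<in> nonzero_primes L"
      using Q by (auto simp: primes_above_def P_def K.carrier_ring_of_integers)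
    interpret Q: num_field_prime L Q by (rule L.num_field_primeI[OF P(2)])
    have "prime_below Q = prime_below P" using contraction_prime_below[of P Q] T(2) P P_def by blast
    thus "Q \<in> (\<Union>P\<in>T. {Q \<in> nonzero_primes L. lies_over_rational Q (prime_below P)})"
      using P Q.lies_over_q Q.q_def by auto
  qed
  show "finite (\<Union>P\<in>T. {Q \<in> nonzero_primes L. lies_over_rational Q (prime_below P)})"
  proof (intro finite_UN_I T(1) L.finite_primes_over)
    fix P assume "P \<in> T"
    then interpret P: num_field_prime K P using T(2) by (intro K.num_field_primeI) auto
    show "Factorial_Ring.prime (prime_below P)" using P.prime_q P.q_def by simp
  qed
qed

end

section \<open>Existence of Galois extensions\<close>

text \<open>Polynomials over a subfield remain in the polynomial type of the ambient field, so that
  roots and degrees need no change of ring.\<close>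

definition polys_over :: "'a::field set \<Rightarrow> 'a poly set" where
  "polys_over M = {p. \<forall>i. Polynomial.coeff p i \<in> M}"

lemma polys_over_pCons_iff: "pCons a p \<in> polys_over M \<longleftrightarrow> a \<in> M \<and> p \<in> polys_over M"
  unfolding polys_over_def mem_Collect_eq coeff_pCons by (auto split: nat.splits)

lemma polys_over_closed:
  assumes M: "subring M (ring_of_type_algebra :: 'a::field ring)"
  shows "0 \<in> polys_over M" "p \<in> polys_over M \<Longrightarrow> r \<in> polys_over M \<Longrightarrow> p + r \<in> polys_over M"
    "p \<in> polys_over M \<Longrightarrow> r \<in> polys_over M \<Longrightarrow> p - r \<in> polys_over M"
    "p \<in> polys_over M \<Longrightarrow> r \<in> polys_over M \<Longrightarrow> p * r \<in> polys_over M"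
    "c \<in> M \<Longrightarrow> Polynomial.monom c n \<in> polys_over M"
  using subring_type_closed(1,4-6)[OF M]
  by (auto simp: polys_over_def coeff_mult intro!: subring_type_closed(8)[OF M])

text \<open>The inductive generation of \<open>simple_extension\<close> is Horner's scheme, that is,
  the recursion along \<open>pCons\<close>.\<close>

lemma simple_extension_eq_poly_image:
  assumes M: "subring M (ring_of_type_algebra :: 'a::field ring)"
  shows "type_ring.simple_extension M a = (\<lambda>p. poly p a) ` polys_over M"
proof (intro equalityI subsetI)
  fix x assume "x \<in> type_ring.simple_extension M a"
  thus "x \<in> (\<lambda>p. poly p a) ` polys_over M"
  proof (induction rule: type_ring.simple_extension.induct)
    case zero
    show ?case using polys_over_closed(1)[OF M] by (auto intro!: image_eqI[of _ _ 0])
  next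
    case (lin x c)
    then obtain p where "p \<in> polys_over M" "x = poly p a" by blast
    thus ?case using lin(2) by (intro image_eqI[of _ _ "pCons c p"]) (auto simp: polys_over_pCons_iff mult.commute)
  qed
next
  fix x assume "x \<in> (\<lambda>p. poly p a) ` polys_over M"
  then obtain p where p: "p \<in> polys_over M" "x = poly p a" by blast
  have "poly p a \<in> type_ring.simple_extension M a" using p(1)
  proof (induction p)
    case 0
    show ?case using type_ring.simple_extension.zero[of M a] by simp
  next
    case (pCons c p)
    hence "poly p a \<otimes>\<^bsub>ring_of_type_algebra\<^esub> a \<oplus>\<^bsub>ring_of_type_algebra\<^esub> c \<in> type_ring.simple_extension M a"
      by (intro type_ring.simple_extension.lin) (auto simp: polys_over_pCons_iff)
    thus ?case by (simp add: add.commute mult.commute)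
  qed
  thus "x \<in> type_ring.simple_extension M a" using p(2) by simp
qed

text \<open>A homomorphism of a subfield as a total function with arbitrary values elsewhere;
  \<open>f 1 = 1\<close> excludes the zero map and so gives injectivity on subfields.\<close>

definition hom_on :: "'a::field set \<Rightarrow> ('a \<Rightarrow> 'a) \<Rightarrow> bool" where
  "hom_on M f \<longleftrightarrow> f 1 = 1 \<and> (\<forall>x\<in>M. \<forall>y\<in>M. f (x + y) = f x + f y \<and> f (x * y) = f x * f y)"

lemma hom_on_subset: "hom_on M f \<Longrightarrow> N \<subseteq> M \<Longrightarrow> hom_on N f"
  unfolding hom_on_def by blast

section \<open>Field homomorphisms on a subfield and their extension by one element\<close>

context
  fixes M :: "'a::field_char_0 set" and f :: "'a \<Rightarrow> 'a"
  assumes M: "subfield M ring_of_type_algebra" and f: "hom_on M f"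
begin

private lemma M_ring: "subring M ring_of_type_algebra"
  using M subfieldE(1) by blast

private lemmas M_closed = subring_type_closed[OF M_ring] subfield_type_closed[OF M]

lemma hom_on_1: "f 1 = 1" and hom_on_add: "x \<in> M \<Longrightarrow> y \<in> M \<Longrightarrow> f (x + y) = f x + f y"
  and hom_on_mult: "x \<in> M \<Longrightarrow> y \<in> M \<Longrightarrow> f (x * y) = f x * f y"
  using f by (auto simp: hom_on_def)

lemma hom_on_0: "f 0 = 0"
  using hom_on_add[of 0 0] M_closed(1) by simp

lemma hom_on_minus: "x \<in> M \<Longrightarrow> f (- x) = - f x"
  using hom_on_add[of x "- x"] M_closed(3)[of x] hom_on_0
    by (simp add: eq_neg_iff_add_eq_0 add.commute)

lemma hom_on_diff: "x \<in> M \<Longrightarrow> y \<in> M \<Longrightarrow> f (x - y) = f x - f y"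
  using hom_on_add[of x "- y"] M_closed(3)[of y] hom_on_minus by simp

lemma hom_on_eq_0: "x \<in> M \<Longrightarrow> f x = 0 \<Longrightarrow> x = 0"
  using hom_on_mult[of x "inverse x"] M_closed(11)[of x] hom_on_1 by (cases "x = 0") auto

lemma hom_on_inj: "inj_on f M"
  using hom_on_eq_0 hom_on_diff M_closed(5) by (intro inj_onI) (metis eq_iff_diff_eq_0)

lemma hom_on_sum: "(\<And>i. i \<in> I \<Longrightarrow> g i \<in> M) \<Longrightarrow> f (sum g I) = (\<Sum>i\<in>I. f (g i))"
  by (induction I rule: infinite_finite_induct) (auto simp: hom_on_0 hom_on_add M_closed(8))

lemma hom_on_power: "x \<in> M \<Longrightarrow> f (x ^ n) = f x ^ n"
  by (induction n) (auto simp: hom_on_1 hom_on_mult M_closed(7))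

lemma hom_on_Rats: "x \<in> \<rat> \<Longrightarrow> f x = x"
proof -
  have nat: "f (of_nat n) = of_nat n" for n
    by (induction n) (simp_all add: hom_on_0 hom_on_1 hom_on_add M_closed(2,10))
  have int: "f (of_int k) = of_int k" for k
    by (cases k rule: int_cases2) (simp_all add: nat hom_on_minus M_closed(10))
  assume "x \<in> \<rat>"
  then obtain a b where ab: "b > 0" "x = of_int a / of_int b" using Rats_cases'[of x] by metis
  hence "f (x * of_int b) = of_int a" by (simp add: int)
  moreover have "f (x * of_int b) = f x * of_int b"
    unfolding ab(2) by (subst hom_on_mult) (auto simp: int intro!: M_closed(9,12))
  moreover have "x * of_int b = of_int a" using ab by simp
  ultimately have "f x * of_int b = x * of_int b" by metis
  thus "f x = x" using ab(1) by simp
qed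

lemma coeff_map_poly_hom: "Polynomial.coeff (map_poly f p) i = f (Polynomial.coeff p i)"
  by (rule coeff_map_poly) (rule hom_on_0)

lemma map_poly_hom_add:
  "p \<in> polys_over M \<Longrightarrow> r \<in> polys_over M \<Longrightarrow> map_poly f (p + r) = map_poly f p + map_poly f r"
  by (rule poly_eqI) (simp add: coeff_map_poly_hom hom_on_add polys_over_def)

lemma map_poly_hom_diff:
  "p \<in> polys_over M \<Longrightarrow> r \<in> polys_over M \<Longrightarrow> map_poly f (p - r) = map_poly f p - map_poly f r"
  by (rule poly_eqI) (simp add: coeff_map_poly_hom hom_on_diff polys_over_def)

lemma map_poly_hom_mult:
  "p \<in> polys_over M \<Longrightarrow> r \<in> polys_over M \<Longrightarrow> map_poly f (p * r) = map_poly f p * map_poly f r"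
  by (rule poly_eqI) (simp add: coeff_map_poly_hom coeff_mult hom_on_sum hom_on_mult polys_over_def M_closed(6))

lemma degree_map_poly_hom: "p \<in> polys_over M \<Longrightarrow> Polynomial.degree (map_poly f p) = Polynomial.degree p"
proof (cases "p = 0")
  case False
  assume "p \<in> polys_over M"
  hence "f (Polynomial.lead_coeff p) \<noteq> 0"
    using False hom_on_eq_0[of "Polynomial.lead_coeff p"] by (auto simp: polys_over_def)
  thus ?thesis by (intro antisym[OF degree_map_poly_le le_degree]) (simp add: coeff_map_poly_hom)
qed simp

lemma poly_map_poly_hom:
  assumes p: "p \<in> polys_over M" and x: "x \<in> M"
  shows "poly (map_poly f p) (f x) = f (poly p x)"
proof -
  have pM: "Polynomial.coeff p i \<in> M" for i using p by (auto simp: polys_over_def)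
  have "f (poly p x) = (\<Sum>i\<le>Polynomial.degree p. f (Polynomial.coeff p i * x ^ i))"
    unfolding poly_altdef
      by (rule hom_on_sum) (use pM x in \<open>auto intro!: M_closed(6,7)\<close>)
  also have "\<dots> = (\<Sum>i\<le>Polynomial.degree p. f (Polynomial.coeff p i) * f x ^ i)"
    using pM x by (intro sum.cong) (auto simp: hom_on_mult hom_on_power M_closed(7))
  finally show ?thesis
    by (simp add: poly_altdef degree_map_poly_hom[OF p] coeff_map_poly_hom)
qed

text \<open>Long division by \<open>m\<close>, one leading term at a time: each step subtracts a
  multiple of \<open>m\<close>, whose image vanishes at \<open>b\<close>. Once the degree is below
  that of \<open>m\<close>, minimality leaves only the zero polynomial.\<close>

lemma root_of_map_minimal_poly:
  assumes m: "m \<in> polys_over M" "m \<noteq> 0" "poly m a = 0"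
    and min: "\<And>p. p \<in> polys_over M \<Longrightarrow> p \<noteq> 0 \<Longrightarrow> poly p a = 0 \<Longrightarrow> Polynomial.degree m \<le> Polynomial.degree p"
    and b: "poly (map_poly f m) b = 0"
    and p: "p \<in> polys_over M" "poly p a = 0"
  shows "poly (map_poly f p) b = 0"
  using p
proof (induction "Polynomial.degree p" arbitrary: p rule: less_induct)
  case less
  show ?case
  proof (cases "p = 0")
    case True
    thus ?thesis by simp
  next
    case False
    have dm: "Polynomial.degree m \<le> Polynomial.degree p" using min less.prems False by blast
    define c where "c = Polynomial.lead_coeff p / Polynomial.lead_coeff m"
    define k where "k = Polynomial.degree p - Polynomial.degree m"
    define t where "t = Polynomial.monom c k"
    have "c \<in> M"
      unfolding c_def using less.prems(1) m(1) by (intro M_closed(12)) (auto simp: polys_over_def)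
    hence t: "t \<in> polys_over M" unfolding t_def by (rule polys_over_closed(5)[OF M_ring])
    define r where "r = p - t * m"
    have tm: "t * m \<in> polys_over M" using t m(1) polys_over_closed(4)[OF M_ring] by blast
    have r: "r \<in> polys_over M" "poly r a = 0"
      using less.prems tm m(3) polys_over_closed(3)[OF M_ring] by (auto simp: r_def)
    have "Polynomial.degree r \<le> Polynomial.degree p"
      unfolding r_def
    proof (rule degree_diff_le)
      have "Polynomial.degree (t * m) \<le> k + Polynomial.degree m"
        unfolding t_def
          by (intro order.trans[OF degree_mult_le] add_mono degree_monom_le order.refl)
      thus "Polynomial.degree (t * m) \<le> Polynomial.degree p" using dm by (simp add: k_def)
    qed simp
    moreover have "Polynomial.coeff r (Polynomial.degree p) = 0"
      using dm m(2) by (simp add: r_def t_def coeff_monom_mult k_def c_def)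
    ultimately have "Polynomial.degree r < Polynomial.degree p \<or> r = 0"
      by (metis le_neq_implies_less leading_coeff_0_iff)
    hence "poly (map_poly f r) b = 0" using less.hyps r by auto
    moreover have "map_poly f r = map_poly f p - map_poly f t * map_poly f m"
      unfolding r_def
        using less.prems(1) tm t m(1) by (simp add: map_poly_hom_diff map_poly_hom_mult)
    ultimately show ?thesis using b by simp
  qed
qed

text \<open>The map sends \<open>poly p a\<close> to the image polynomial evaluated at
  \<open>b\<close>. It is well defined because the difference of two representatives vanishes at
  \<open>a\<close>, hence its image vanishes at \<open>b\<close>.\<close>

lemma hom_on_extend:
  assumes m: "m \<in> polys_over M" "m \<noteq> 0" "poly m a = 0"
    and min: "\<And>p. p \<in> polys_over M \<Longrightarrow> p \<noteq> 0 \<Longrightarrow> poly p a = 0 \<Longrightarrow> Polynomial.degree m \<le> Polynomial.degree p"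
    and b: "poly (map_poly f m) b = 0"
  obtains g where "hom_on (type_ring.simple_extension M a) g" "\<forall>x\<in>M. g x = f x" "g a = b"
proof -
  define g where "g x = poly (map_poly f (SOME p. p \<in> polys_over M \<and> poly p a = x)) b" for x
  have g: "g (poly p a) = poly (map_poly f p) b" if p: "p \<in> polys_over M" for p
  proof -
    define r where "r = (SOME r. r \<in> polys_over M \<and> poly r a = poly p a)"
    have r: "r \<in> polys_over M" "poly r a = poly p a"
      using someI_ex[of "\<lambda>r. r \<in> polys_over M \<and> poly r a = poly p a"] p
        by (auto simp: r_def)
    have "poly (map_poly f (r - p)) b = 0"
      using r p by (intro root_of_map_minimal_poly[OF m min b]) (auto intro: polys_over_closed(3)[OF M_ring])
    thus ?thesis using r p by (simp add: map_poly_hom_diff g_def r_def)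
  qed
  show ?thesis
  proof (rule that)
    have const: "[:x:] \<in> polys_over M" if "x \<in> M" for x
      using that polys_over_closed(1)[OF M_ring] by (simp add: polys_over_pCons_iff)
    show gM: "\<forall>x\<in>M. g x = f x"
    proof
      fix x assume x: "x \<in> M"
      have "map_poly f [:x:] = [:f x:]"
        by (rule poly_eqI) (simp add: coeff_map_poly_hom coeff_pCons hom_on_0 split: nat.splits)
      thus "g x = f x" using g[OF const[OF x]] by simp
    qed
    have "[:0, 1:] \<in> polys_over M" using M_closed(1,2) const by (simp add: polys_over_pCons_iff)
    moreover have "map_poly f [:0, 1:] = [:0, 1:]"
      by (rule poly_eqI) (simp add: coeff_map_poly_hom coeff_pCons hom_on_0 hom_on_1 split: nat.splits)
    ultimately show "g a = b" using g[of "[:0, 1:]"] by simp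
    show "hom_on (type_ring.simple_extension M a) g"
      unfolding hom_on_def
    proof (intro conjI ballI)
      show "g 1 = 1" using gM M_closed(2) hom_on_1 by simp
      fix x y assume "x \<in> type_ring.simple_extension M a" "y \<in> type_ring.simple_extension M a"
      then obtain p r
        where p: "p \<in> polys_over M" "x = poly p a" and r: "r \<in> polys_over M" "y = poly r a"
        unfolding simple_extension_eq_poly_image[OF M_ring] by blast
      show "g (x + y) = g x + g y"
        using g[OF polys_over_closed(2)[OF M_ring p(1) r(1)]] p r g by (simp add: map_poly_hom_add)
      show "g (x * y) = g x * g y"
        using g[OF polys_over_closed(4)[OF M_ring p(1) r(1)]] p r g by (simp add: map_poly_hom_mult)
    qed
  qed
qed

end

section \<open>Embeddings into an algebraically closed field\<close>

lemma ex_minimal_poly: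
  assumes M: "\<rat> \<subseteq> M" and a: "algebraic (a::'a::field_char_0)"
  obtains m where "m \<in> polys_over M" "m \<noteq> 0" "poly m a = 0"
    "\<forall>p. p \<in> polys_over M \<longrightarrow> p \<noteq> 0 \<longrightarrow> poly p a = 0 \<longrightarrow> Polynomial.degree m \<le> Polynomial.degree p"
proof -
  obtain p where p: "\<forall>i. Polynomial.coeff p i \<in> \<rat>" "p \<noteq> 0" "poly p a = 0"
    using a unfolding algebraic_altdef by blast
  have "p \<in> polys_over M \<and> p \<noteq> 0 \<and> poly p a = 0"
    using p M by (auto simp: polys_over_def)
  from ex_has_least_nat[of "\<lambda>p. p \<in> polys_over M \<and> p \<noteq> 0 \<and> poly p a = 0", OF this, of Polynomial.degree]
  show ?thesis using that by blast
qed

lemma degree_pos_if_root: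
  assumes "p \<noteq> 0" "poly p a = 0"
  shows "Polynomial.degree p > 0"
proof (rule ccontr)
  assume "\<not> Polynomial.degree p > 0"
  then obtain c where "p = [:c:]" by (metis degree_eq_zeroE neq0_conv)
  thus False using assms by simp
qed

lemma type_ring_pow [simp]: "x [^]\<^bsub>ring_of_type_algebra\<^esub> n = (x::'a::field) ^ n"
  by (induction n) (simp_all add: mult.commute)

lemma type_ring_eval: "type_ring.eval xs x = poly (Poly (rev xs)) (x::'a::field)"
  by (induction xs) (simp_all add: Poly_append poly_monom)

lemma algebraic_over_subfield:
  assumes M: "\<rat> \<subseteq> M" and a: "algebraic (a::'a::field_char_0)"
  shows "(type_ring.algebraic over M) a"
proof -
  obtain p where p: "\<forall>i. Polynomial.coeff p i \<in> \<rat>" "p \<noteq> 0" "poly p a = 0"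
    using a unfolding algebraic_altdef by blast
  show ?thesis
  proof (rule type_ring.algebraicI)
    \<comment> \<open>Polynomials as lists carry the leading coefficient at the head, hence the
      reversal.\<close>
    have "set (coeffs p) \<subseteq> M" using p(1) M by (auto simp: coeffs_def)
    moreover have "last (coeffs p) \<noteq> 0" using p(2) by (simp add: last_coeffs_eq_coeff_degree)
    ultimately show "rev (coeffs p) \<in> carrier (univ_poly ring_of_type_algebra M)"
      using p(2) by (auto simp: univ_poly_def polynomial_def hd_rev)
    show "rev (coeffs p) \<noteq> []" using p(2) by simp
    show "type_ring.eval (rev (coeffs p)) a = \<zero>\<^bsub>ring_of_type_algebra\<^esub>"
      using p(3) by (simp add: type_ring_eval)
  qed
qed

lemma finite_extension_Cons:
  "type_ring.finite_extension M (x # xs) = type_ring.simple_extension (type_ring.finite_extension M xs) x"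
  by simp

lemma subfield_finite_extension:
  assumes M: "subfield M (ring_of_type_algebra :: 'a::field_char_0 ring)" and xs: "\<forall>x\<in>set xs. algebraic x"
  shows "subfield (type_ring.finite_extension M xs) ring_of_type_algebra"
    "type_ring.finite_dimension M (type_ring.finite_extension M xs)"
  using type_ring.finite_extension_is_subfield[OF M, of xs] type_ring.finite_extension_finite_dimension(1)[OF M, of xs]
    algebraic_over_subfield[OF subfield_type_closed(4)[OF M]] xs
      by (simp_all del: type_ring.finite_extension.simps)

text \<open>At each adjunction the image of the minimal polynomial keeps its positive degree, so
  algebraic closedness supplies an image for the new generator.\<close>

lemma hom_on_extend_finite:
  fixes M :: "'a::{field_char_0, alg_closed_field} set"
  assumes M: "subfield M ring_of_type_algebra" and f: "hom_on M f" and xs: "\<forall>x\<in>set xs. algebraic x"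
  shows "\<exists>g. hom_on (type_ring.finite_extension M xs) g \<and> (\<forall>x\<in>M. g x = f x)"
  using xs
proof (induction xs)
  case Nil
  thus ?case using f by auto
next
  case (Cons x xs)
  let ?N = "type_ring.finite_extension M xs"
  obtain g where g: "hom_on ?N g" "\<forall>x\<in>M. g x = f x" using Cons by auto
  have N: "subfield ?N ring_of_type_algebra"
    using subfield_finite_extension(1)[OF M] Cons.prems by simp
  have MN: "M \<subseteq> ?N" by (rule type_ring.finite_extension_incl) auto
  obtain m where m: "m \<in> polys_over ?N" "m \<noteq> 0" "poly m x = 0"
    "\<forall>p. p \<in> polys_over ?N \<longrightarrow> p \<noteq> 0 \<longrightarrow> poly p x = 0 \<longrightarrow> Polynomial.degree m \<le> Polynomial.degree p"
    using ex_minimal_poly[OF subfield_type_closed(4)[OF N], of x] Cons.prems by auto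
  have "Polynomial.degree (map_poly g m) > 0"
    using degree_map_poly_hom[OF N g(1) m(1)] degree_pos_if_root[OF m(2,3)] by simp
  then obtain b where b: "poly (map_poly g m) b = 0" using alg_closed_imp_poly_has_root by blast
  obtain h where h: "hom_on (type_ring.simple_extension ?N x) h" "\<forall>y\<in>?N. h y = g y"
    using hom_on_extend[OF N g(1) m(1-3) _ b] m(4) by blast
  show ?case
  proof (intro exI conjI)
    show "hom_on (type_ring.finite_extension M (x # xs)) h"
      using h(1) unfolding finite_extension_Cons .
    show "\<forall>y\<in>M. h y = f y" using h(2) g(2) MN by auto
  qed
qed

text \<open>The minimal polynomial of \<open>x\<close> has degree at least 2 and no multiple roots, hence another root.\<close>

lemma ex_hom_moving:
  fixes x :: "'a::{field_char_0, alg_closed_field}"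
  assumes x: "algebraic x" "x \<notin> \<rat>"
  obtains g where "hom_on (type_ring.simple_extension \<rat> x) g" "g x \<noteq> x"
proof -
  have Q: "subring \<rat> (ring_of_type_algebra :: 'a ring)" using subfieldE(1)[OF subfield_Rats] .
  obtain m where m: "m \<in> polys_over \<rat>" "m \<noteq> 0" "poly m x = 0"
    "\<forall>p. p \<in> polys_over \<rat> \<longrightarrow> p \<noteq> 0 \<longrightarrow> poly p x = 0 \<longrightarrow> Polynomial.degree m \<le> Polynomial.degree p"
    using ex_minimal_poly[OF order.refl x(1)] .
  have deg: "Polynomial.degree m > 0" by (rule degree_pos_if_root[OF m(2,3)])
  have mQ: "Polynomial.coeff m i \<in> \<rat>" for i using m(1) by (auto simp: polys_over_def)
  have "Polynomial.degree m \<noteq> 1"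
  proof
    assume 1: "Polynomial.degree m = 1"
    hence "Polynomial.coeff m 0 + Polynomial.coeff m 1 * x = 0"
      using m(3) by (simp add: poly_altdef)
    moreover have "Polynomial.coeff m 1 \<noteq> 0" using 1 m(2) by (metis leading_coeff_0_iff)
    ultimately have "x = - Polynomial.coeff m 0 / Polynomial.coeff m 1"
      by (simp add: field_simps eq_neg_iff_add_eq_0)
    thus False using x(2) mQ by (metis Rats_divide Rats_minus_iff)
  qed
  have "[:- x, 1:] dvd m" using m(3) by (simp add: poly_eq_0_iff_dvd)
  then obtain h where h: "m = [:- x, 1:] * h" by blast
  have h0: "h \<noteq> 0" using h m(2) by auto
  have "Polynomial.degree m = 1 + Polynomial.degree h"
    unfolding h using h0 by (subst degree_mult_eq) auto
  hence "Polynomial.degree h > 0" using deg \<open>Polynomial.degree m \<noteq> 1\<close> by simp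
  then obtain y where y: "poly h y = 0" using alg_closed_imp_poly_has_root by blast
  \<comment> \<open>Separability: \<open>pderiv m\<close> is nonzero of smaller degree, so by
    minimality it does not vanish at \<open>x\<close>. Its value there is \<open>poly h x\<close>,
    hence the root \<open>y\<close> of \<open>h\<close> differs from \<open>x\<close>.\<close>
  have "pderiv m \<in> polys_over \<rat>"
    using mQ by (auto simp: polys_over_def coeff_pderiv intro!: Rats_mult)
  moreover have "pderiv m \<noteq> 0" using deg by (simp add: pderiv_eq_0_iff)
  ultimately have "poly (pderiv m) x \<noteq> 0" using m(4) deg degree_pderiv[of m] by fastforce
  moreover have "poly (pderiv m) x = poly h x" unfolding h pderiv_mult by (simp add: pderiv_pCons)
  ultimately have "y \<noteq> x" using y by auto
  have id: "hom_on \<rat> (\<lambda>x. x :: 'a)" by (simp add: hom_on_def)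
  have "map_poly (\<lambda>x. x) m = m" by (simp add: poly_eqI coeff_map_poly)
  moreover have "poly m y = 0" using y h by simp
  ultimately have "poly (map_poly (\<lambda>x. x) m) y = 0" by simp
  then obtain g where "hom_on (type_ring.simple_extension \<rat> x) g" "g x = y"
    using hom_on_extend[OF subfield_Rats id m(1-3)] m(4) by blast
  thus ?thesis using that \<open>y \<noteq> x\<close> by blast
qed

lemma ex_poly_of_int_relation:
  fixes y :: "'a::field_char_0" and c :: "nat \<Rightarrow> int"
  assumes c: "\<exists>i\<le>N. c i \<noteq> 0" "(\<Sum>i\<le>N. of_int (c i) * y ^ i) = 0"
  shows "\<exists>p. p \<in> polys_over \<rat> - {0} \<and> poly p y = 0"
proof -
  define p where "p = (\<Sum>i\<le>N. Polynomial.monom (of_int (c i) :: 'a) i)"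
  have co: "Polynomial.coeff p i = (if i \<le> N then of_int (c i) else 0)" for i
    by (simp add: p_def coeff_sum)
  have "p \<in> polys_over \<rat>" by (simp add: polys_over_def co)
  moreover have "p \<noteq> 0"
  proof
    assume "p = 0"
    hence "\<forall>i\<le>N. c i = 0" using co by (metis coeff_0 of_int_eq_0_iff)
    thus False using c(1) by blast
  qed
  moreover have "poly p y = 0" using c(2) by (simp add: p_def poly_sum poly_monom)
  ultimately show ?thesis by blast
qed

lemma (in num_field) algebraic_K:
  assumes "x \<in> K"
  shows "algebraic x"
proof -
  obtain N and c :: "nat \<Rightarrow> int"
    where c: "\<exists>i\<le>N. c i \<noteq> 0" "(\<Sum>i\<le>N. of_int (c i) * x ^ i) = 0"
    using power_relation[OF assms] .
  show ?thesis using ex_poly_of_int_relation[OF c] by (auto simp: algebraic_altdef polys_over_def)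
qed

text \<open>An embedding of \<open>L\<close> permutes the roots in \<open>xs\<close>, because the
  polynomials have rational coefficients. Hence an embedding that moves a given irrational
  \<open>x\<close> is already an automorphism.\<close>

lemma galois_over_rat_splitting_field:
  fixes A :: "'a::{field_char_0, alg_closed_field} poly set"
  assumes A: "finite A" "A \<subseteq> polys_over \<rat> - {0}" and xs: "set xs = (\<Union>p\<in>A. {x. poly p x = 0})"
  shows "galois_over_rat (type_ring.finite_extension \<rat> xs)" (is "galois_over_rat ?L")
proof -
  have alg: "\<forall>x\<in>set xs. algebraic x"
    unfolding xs algebraic_altdef using A(2) by (auto simp: polys_over_def)
  have L: "subfield ?L ring_of_type_algebra" "type_ring.finite_dimension \<rat> ?L"
    using subfield_finite_extension[OF subfield_Rats alg] by auto
  have L_ring: "subring ?L ring_of_type_algebra" using subfieldE(1)[OF L(1)] .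
  have xsL: "set xs \<subseteq> ?L"
    using type_ring.finite_extension_mem[OF subfieldE(1)[OF subfield_Rats], of xs] by simp
  have QL: "\<rat> \<subseteq> ?L" using subfield_type_closed(4)[OF L(1)] .
  let ?R = "ring_of_type_algebra\<lparr>carrier := ?L\<rparr>"
  have iso_hom: "hom_on ?L s" if "s \<in> ring_iso ?R ?R" for s
    using that by (auto simp: ring_iso_def Ring.ring_hom_def hom_on_def simp del: type_ring.finite_extension.simps)
  have "\<exists>s\<in>ring_iso ?R ?R. s x \<noteq> x" if x: "x \<in> ?L" "x \<notin> \<rat>" for x
  proof -
    have "number_field ?L" using L by (simp add: number_field_def)
    hence "algebraic x" using num_field.algebraic_K[OF num_field.intro] x(1) by blast
    then obtain f where f: "hom_on (type_ring.simple_extension \<rat> x) f" "f x \<noteq> x"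
      using ex_hom_moving x(2) by blast
    let ?M = "type_ring.simple_extension \<rat> x"
    have M: "subfield ?M ring_of_type_algebra"
      using subfield_finite_extension(1)[OF subfield_Rats, of "[x]"] \<open>algebraic x\<close>
        by simp
    have xM: "x \<in> ?M"
      using type_ring.simple_extension_mem[OF subfieldE(1)[OF subfield_Rats]] by simp
    \<comment> \<open>The roots are adjoined to \<open>\<rat>(x)\<close> instead of
      \<open>\<rat>\<close>, so that the extended map keeps the value \<open>f x\<close>; it is then
      restricted to \<open>L\<close>.\<close>
    obtain s where s0: "hom_on (type_ring.finite_extension ?M xs) s" "\<forall>y\<in>?M. s y = f y"
      using hom_on_extend_finite[OF M f(1) alg] by blast
    have "?L \<subseteq> type_ring.finite_extension ?M xs"
      by (rule type_ring.mono_finite_extension) (rule subfield_type_closed(4)[OF M])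
    hence s: "hom_on ?L s" using s0(1) hom_on_subset by blast
    have sx: "s x \<noteq> x" using s0(2) f(2) xM by auto
    have s_xs: "s y \<in> set xs" if y: "y \<in> set xs" for y
    proof -
      obtain p where p: "p \<in> A" "poly p y = 0" using y xs by auto
      have pL: "p \<in> polys_over ?L" and pQ: "\<And>i. Polynomial.coeff p i \<in> \<rat>"
        using A(2) p(1) QL unfolding polys_over_def by blast+
      have "map_poly s p = p"
        by (rule poly_eqI) (simp add: coeff_map_poly_hom[OF L(1) s] hom_on_Rats[OF L(1) s pQ])
      hence "poly p (s y) = s (poly p y)"
        using poly_map_poly_hom[OF L(1) s pL, of y] y xsL by auto
      hence "poly p (s y) = 0" using p(2) hom_on_0[OF L(1) s] by simp
      thus ?thesis using p(1) xs by blast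
    qed
    have inj: "inj_on s ?L" by (rule hom_on_inj[OF L(1) s])
    \<comment> \<open>The elements of \<open>L\<close> sent into \<open>L\<close> form a subring
      containing \<open>\<rat>\<close> and the roots, hence all of \<open>L\<close>.\<close>
    have sL: "s y \<in> ?L" if "y \<in> ?L" for y
    proof -
      have "subring {y \<in> ?L. s y \<in> ?L} ring_of_type_algebra"
        unfolding subring_type_iff
        using subring_type_closed(2-4,6)[OF L_ring] hom_on_1[OF L(1) s] hom_on_add[OF L(1) s] hom_on_mult[OF L(1) s]
          hom_on_minus[OF L(1) s] by (auto simp del: type_ring.finite_extension.simps)
      moreover have "\<rat> \<subseteq> {y \<in> ?L. s y \<in> ?L}"
        using QL hom_on_Rats[OF L(1) s] by auto
      moreover have "set xs \<subseteq> {y \<in> ?L. s y \<in> ?L}" using xsL s_xs by blast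
      ultimately have "?L \<subseteq> {y \<in> ?L. s y \<in> ?L}"
        by (rule type_ring.finite_extension_subring_incl)
      thus ?thesis using that by blast
    qed
    \<comment> \<open>Surjectivity: an injection of the finite set of roots into itself is onto, so
      the image of \<open>L\<close> contains all generators.\<close>
    have "s ` set xs = set xs"
      using s_xs inj_on_subset[OF inj xsL] by (intro endo_inj_surj) auto
    hence "set xs \<subseteq> s ` ?L" using xsL by blast
    moreover have "subring (s ` ?L) ring_of_type_algebra"
      unfolding subring_type_iff
    proof (intro conjI ballI)
      show "1 \<in> s ` ?L"
        using hom_on_1[OF L(1) s] subring_type_closed(2)[OF L_ring] by (metis imageI)
      fix a assume "a \<in> s ` ?L"
      then obtain a' where a: "a' \<in> ?L" "a = s a'" by blast
      show "- a \<in> s ` ?L"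
        using hom_on_minus[OF L(1) s a(1)] subring_type_closed(3)[OF L_ring a(1)] a(2)
          by (metis imageI)
      fix b assume "b \<in> s ` ?L"
      then obtain b' where b: "b' \<in> ?L" "b = s b'" by blast
      show "a + b \<in> s ` ?L"
        using hom_on_add[OF L(1) s a(1) b(1)] subring_type_closed(4)[OF L_ring a(1) b(1)] a(2) b(2)
          by (metis imageI)
      show "a * b \<in> s ` ?L"
        using hom_on_mult[OF L(1) s a(1) b(1)] subring_type_closed(6)[OF L_ring a(1) b(1)] a(2) b(2)
          by (metis imageI)
    qed
    moreover have "\<rat> \<subseteq> s ` ?L"
      using hom_on_Rats[OF L(1) s] QL by (metis image_eqI subsetD subsetI)
    ultimately have "?L \<subseteq> s ` ?L"
      by (intro type_ring.finite_extension_subring_incl)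
    hence "bij_betw s ?L ?L"
      using inj sL by (auto simp: bij_betw_def simp del: type_ring.finite_extension.simps)
    hence "s \<in> ring_iso ?R ?R"
      using s sL by (simp add: ring_iso_def Ring.ring_hom_def hom_on_def del: type_ring.finite_extension.simps)
    thus ?thesis using sx by blast
  qed
  moreover have "s x = x" if "s \<in> ring_iso ?R ?R" "x \<in> \<rat>" for s x
    using hom_on_Rats[OF L(1) iso_hom[OF that(1)] that(2)] .
  ultimately have "{x \<in> ?L. \<forall>s\<in>ring_iso ?R ?R. s x = x} = \<rat>" using QL by blast
  thus ?thesis
    using L by (simp add: galois_over_rat_def number_field_def del: type_ring.finite_extension.simps)
qed

text \<open>\<open>L\<close> is the splitting field of polynomials annihilating a spanning list of
  \<open>K\<close>; the image of \<open>K\<close> consists of rational combinations of some of the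
  roots.\<close>

lemma (in num_field) ex_galois_extension:
  "\<exists>L. galois_over_rat L \<and> to_ac ` K \<subseteq> L"
proof -
  obtain n where n: "type_ring.dimension n \<rat> K"
    using number_field unfolding number_field_def type_ring.finite_dimension_def by blast
  obtain vs where vs: "type_ring.Span \<rat> vs = K"
    using type_ring.exists_base[OF subfield_Rats n] by blast
  have vsK: "set vs \<subseteq> K"
    using type_ring.Span_base_incl[OF subfield_Rats, of vs] vs by simp
  have "\<exists>p. p \<in> polys_over \<rat> - {0} \<and> poly p (to_ac v) = 0" if v: "v \<in> set vs" for v
  proof -
    obtain N and c :: "nat \<Rightarrow> int"
      where c: "\<exists>i\<le>N. c i \<noteq> 0" "(\<Sum>i\<le>N. of_int (c i) * v ^ i) = 0"
      using power_relation[of v] v vsK by blast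
    have "(\<Sum>i\<le>N. of_int (c i) * to_ac v ^ i) = to_ac (\<Sum>i\<le>N. of_int (c i) * v ^ i)"
      by (simp add: to_ac_sum)
    thus ?thesis using c ex_poly_of_int_relation[of N c "to_ac v"] by simp
  qed
  then obtain P
    where P: "\<And>v. v \<in> set vs \<Longrightarrow> P v \<in> polys_over \<rat> - {0} \<and> poly (P v) (to_ac v) = 0" by metis
  define A where "A = P ` set vs"
  have A: "finite A" "A \<subseteq> polys_over \<rat> - {0}" using P by (auto simp: A_def)
  have "finite (\<Union>p\<in>A. {x. poly p x = 0})" using A by (auto intro!: poly_roots_finite)
  then obtain xs where xs: "set xs = (\<Union>p\<in>A. {x. poly p x = 0})"
    using finite_list by blast
  define L where "L = type_ring.finite_extension \<rat> xs"
  have gal: "galois_over_rat L" unfolding L_def by (rule galois_over_rat_splitting_field[OF A xs])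
  have L: "subfield L ring_of_type_algebra"
    using gal by (simp add: galois_over_rat_def number_field_def)
  have L_ring: "subring L ring_of_type_algebra" using subfieldE(1)[OF L] .
  have vsL: "to_ac v \<in> L" if "v \<in> set vs" for v
  proof -
    have "to_ac v \<in> set xs" using P[OF that] that unfolding xs A_def by blast
    thus ?thesis
      using type_ring.finite_extension_mem[OF subfieldE(1)[OF subfield_Rats], of xs]
        by (auto simp: L_def)
  qed
  have "to_ac ` K \<subseteq> L"
  proof
    fix y assume "y \<in> to_ac ` K"
    then obtain x where x: "x \<in> K" "y = to_ac x" by blast
    obtain ks where ks: "set ks \<subseteq> \<rat>" "length ks = length vs" "x = type_ring.combine ks vs"
      using type_ring.Span_mem_iff_length_version[OF subfield_Rats, of vs x] x(1) vs by auto
    have "to_ac (ks ! i * vs ! i) \<in> L" if i: "i < length vs" for i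
    proof -
      have "ks ! i \<in> \<rat>" using ks i by (metis nth_mem subsetD)
      then obtain r s where "ks ! i = of_int r / of_int s" using Rats_cases'[of "ks ! i"] by metis
      hence "to_ac (ks ! i) = of_int r / of_int s" by simp
      hence "to_ac (ks ! i) \<in> L"
        using subfield_type_closed(2)[OF L] subring_type_closed(9)[OF L_ring] by metis
      thus ?thesis using vsL[of "vs ! i"] i subring_type_closed(6)[OF L_ring] by simp
    qed
    hence "to_ac x \<in> L"
      unfolding ks(3) type_ring_combine_map[OF ks(2)] to_ac_sum
        by (intro subring_type_closed(8)[OF L_ring]) auto
    thus "y \<in> L" using x by simp
  qed
  thus ?thesis using gal by blast
qed

section \<open>The subderivative\<close>

lemma (in Metric_space) not_topcontinuous_at:
  assumes x: "x \<in> M" and e: "e > 0"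
    and far: "\<And>r. r > 0 \<Longrightarrow> \<exists>y\<in>M. d x y < r \<and> e \<le> d (f x) (f y)"
  shows "\<not> topcontinuous_at mtopology mtopology f x"
proof
  assume cont: "topcontinuous_at mtopology mtopology f x"
  hence fx: "f x \<in> M" using x by (auto simp: topcontinuous_at_def)
  have "openin mtopology (mball (f x) e) \<and> f x \<in> mball (f x) e" using fx e by simp
  then obtain U
    where U: "openin mtopology U" "x \<in> U" "\<forall>y\<in>U. f y \<in> mball (f x) e"
    using cont unfolding topcontinuous_at_def by blast
  then obtain r where r: "r > 0" "mball x r \<subseteq> U" by (auto simp: openin_mtopology)
  obtain y where y: "y \<in> M" "d x y < r" "e \<le> d (f x) (f y)" using far[OF r(1)] by blast
  hence "y \<in> U" using r(2) x by auto
  thus False using U(3) y(3) by auto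
qed

section \<open>The metric at a prime\<close>

context num_field_prime
begin

lemma ord_add_eq:
  assumes "x \<in> K" "x \<noteq> 0" "y \<in> K" "y \<noteq> 0" "ord y < ord x"
  shows "x + y \<noteq> 0" "ord (x + y) = ord y"
proof -
  show nz: "x + y \<noteq> 0"
  proof
    assume "x + y = 0"
    hence "x = - y" by (simp add: eq_neg_iff_add_eq_0)
    thus False using assms ord_minus[of y] by simp
  qed
  have "min (ord x) (ord y) \<le> ord (x + y)" by (rule ord_add) (use assms nz in auto)
  \<comment> \<open>Applied to \<open>y = (x + y) + (- x)\<close>, the ultrametric inequality bounds
    \<open>ord (x + y)\<close> from above.\<close>
  moreover have "min (ord (x + y)) (ord (- x)) \<le> ord (x + y + - x)"
    by (rule ord_add) (use assms nz K_closed(3,4) in auto)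
  ultimately show "ord (x + y) = ord y" using assms ord_minus[of x] by simp
qed

lemma val_add:
  assumes "x \<in> K" "x \<noteq> 0" "y \<in> K" "y \<noteq> 0" "x + y \<noteq> 0"
  shows "min (val x) (val y) \<le> val (x + y)"
proof -
  have "ord x \<le> ord (x + y) \<or> ord y \<le> ord (x + y)" using ord_add[OF assms] by linarith
  hence "val x \<le> val (x + y) \<or> val y \<le> val (x + y)"
    using ord_q_pos by (auto simp: val_eq divide_right_mono)
  thus ?thesis by linarith
qed

text \<open>\<open>Metric_space\<close> demands symmetry on the whole type. Off \<open>K\<close>,
  neither \<open>x\<close> nor \<open>- x\<close> is a fraction, so both orders are given by the
  same unsatisfiable description.\<close>

lemma ord_minus': "ord (- x) = ord x"
proof (cases "x \<in> K")
  case True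
  thus ?thesis using ord_minus[of x] by (cases "x = 0") auto
next
  case False
  have "y \<noteq> a / b" if "y \<notin> K" "a \<in> OK - {0}" "b \<in> OK - {0}" for y a b
    using that OK_subset K_closed(12)[of a b] by auto
  moreover have "- x \<notin> K" using False K_closed(3)[of "- x"] by auto
  ultimately show ?thesis using False unfolding prime_ord_def carrier_ring_of_integers by metis
qed

context
  fixes c :: real
  assumes c: "0 < c" "c < 1"
begin

abbreviation absP :: "'a \<Rightarrow> real" where "absP \<equiv> padic_abs c K P"

lemma padic_abs_triangle:
  assumes "x \<in> K" "y \<in> K"
  shows "absP (x + y) \<le> absP x + absP y"
proof (cases "x = 0 \<or> y = 0 \<or> x + y = 0")
  case True
  thus ?thesis by (auto simp: padic_abs_def)
next
  case False
  hence "val x \<le> val (x + y) \<or> val y \<le> val (x + y)" using val_add assms by fastforce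
  hence "(of_rat (val x) :: real) \<le> of_rat (val (x + y)) \<or> (of_rat (val y) :: real) \<le> of_rat (val (x + y))"
    by (simp add: of_rat_less_eq)
  hence "absP (x + y) \<le> absP x \<or> absP (x + y) \<le> absP y"
    using False c by (auto simp: padic_abs_def intro!: powr_mono')
  moreover have "0 \<le> absP x" "0 \<le> absP y" by (auto simp: padic_abs_def)
  ultimately show ?thesis by linarith
qed

lemma padic_abs_minus: "absP (- x) = absP x"
  by (simp add: padic_abs_def val_eq ord_minus')

lemma Metric_space_padic: "Metric_space K (\<lambda>x y. absP (x - y))"
proof
  fix x y z
  show "0 \<le> absP (x - y)" by (simp add: padic_abs_def)
  show "absP (x - y) = absP (y - x)" using padic_abs_minus[of "x - y"] by simp
  show "(absP (x - y) = 0) = (x = y)" using c by (simp add: padic_abs_def)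
  assume "x \<in> K" "y \<in> K" "z \<in> K"
  thus "absP (x - z) \<le> absP (x - y) + absP (y - z)"
    using padic_abs_triangle[of "x - y" "y - z"] K_closed(5) by simp
qed

lemma ex_small_padic_abs:
  assumes x: "x \<in> K" "x \<noteq> 0" and r: "r > 0"
  obtains N where "\<And>k u. N \<le> k \<Longrightarrow> u \<in> Pw k \<Longrightarrow> absP (x * u) < r"
proof -
  define e where "e = ord (of_nat q)"
  have e: "e > 0" using ord_q_pos by (simp add: e_def)
  \<comment> \<open>Nonzero elements of \<open>P^k\<close> have value at least \<open>k / e\<close>.
    As \<open>c < 1\<close>, the condition \<open>c powr (val x + k / e) < r\<close> amounts to
    \<open>log c r < val x + k / e\<close>; the summand 1 makes it strict.\<close>
  define N where "N = nat \<lceil>of_int e * (log c r - of_rat (val x)) + 1\<rceil>"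
  show ?thesis
  proof (rule that)
    fix k u assume k: "N \<le> k" and u: "u \<in> Pw k"
    show "absP (x * u) < r"
    proof (cases "u = 0")
      case True
      thus ?thesis using r by (simp add: padic_abs_def)
    next
      case False
      have uO: "u \<in> OK" using u Pw_closed(1) by blast
      have "int k \<le> ord u" using ord_ge_iff[OF uO False] u by blast
      hence "(of_int (int k) :: real) / of_int e \<le> of_int (ord u) / of_int e"
        using e by (intro divide_right_mono) auto
      hence 1: "real k / of_int e \<le> of_rat (val u)" by (simp add: val_eq e_def of_rat_divide)
      have "of_int e * (log c r - of_rat (val x)) + 1 \<le> real k"
        using k unfolding N_def by linarith
      hence "of_int e * (log c r - of_rat (val x)) < real k" by linarith
      hence "log c r - of_rat (val x) < real k / of_int e"
        using e by (simp add: pos_less_divide_eq mult.commute)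
      hence "log c r < of_rat (val x) + of_rat (val u)" using 1 by linarith
      also have "\<dots> = of_rat (val (x * u))"
        using val_mult[OF x subsetD[OF OK_subset uO] False] by (simp add: of_rat_add)
      finally have "c powr of_rat (val (x * u)) < c powr (log c r)"
        using c by (intro powr_less_mono')
      thus ?thesis using x False c r by (simp add: padic_abs_def)
    qed
  qed
qed

end

end

lemma to_ac_of_rat [simp]: "to_ac (of_rat r) = of_rat (r::rat)"
  by (cases r) (simp add: of_rat_rat)

section \<open>The logarithmic derivative\<close>

context num_field_extension
begin

text \<open>The factor \<open>D x / x\<close>. The index set does not depend on \<open>x\<close>,
  unlike that of \<open>galois_subderiv\<close>, so additivity holds term by term; for finite
  \<open>T\<close> both sums agree.\<close>

definition log_deriv :: "'a set set \<Rightarrow> 'a \<Rightarrow> rat" where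
  "log_deriv T x = (\<Sum>Q\<in>primes_above K T L.
     prime_val L Q (to_ac x) / (of_nat (prime_below Q) * of_nat (num_primes_over (prime_below Q) L)))"

lemma galois_subderiv_to_ac:
  assumes T: "finite T" "T \<subseteq> nonzero_primes K" and x: "x \<noteq> 0"
  shows "galois_subderiv L (primes_above K T L) (to_ac x) = to_ac (x * of_rat (log_deriv T x))"
proof -
  have "(\<Sum>Q\<in>{Q \<in> primes_above K T L. prime_val L Q (to_ac x) \<noteq> 0}.
       prime_val L Q (to_ac x) / (of_nat (prime_below Q) * of_nat (num_primes_over (prime_below Q) L)))
      = log_deriv T x"
    unfolding log_deriv_def by (rule sum.mono_neutral_left[OF finite_primes_above[OF T]]) auto
  thus ?thesis using x by (simp add: galois_subderiv_def)
qed

lemma primes_above_prime: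
  assumes "Q \<in> primes_above K T L"
  shows "Q \<in> nonzero_primes L" "to_ac -` Q \<inter> K.OK \<in> T"
  using assms by (auto simp: primes_above_def K.carrier_ring_of_integers)

lemma log_deriv_mult:
  assumes "x \<in> K" "x \<noteq> 0" "y \<in> K" "y \<noteq> 0"
  shows "log_deriv T (x * y) = log_deriv T x + log_deriv T y"
  unfolding log_deriv_def sum.distrib[symmetric]
proof (rule sum.cong)
  fix Q assume "Q \<in> primes_above K T L"
  then interpret Q: num_field_prime L Q using primes_above_prime by (intro L.num_field_primeI) auto
  have "Q.val (to_ac x * to_ac y) = Q.val (to_ac x) + Q.val (to_ac y)"
    using assms to_ac_K by (intro Q.val_mult) auto
  thus "Q.val (to_ac (x * y)) / (of_nat (prime_below Q) * of_nat (num_primes_over (prime_below Q) L))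
     = Q.val (to_ac x) / (of_nat (prime_below Q) * of_nat (num_primes_over (prime_below Q) L))
     + Q.val (to_ac y) / (of_nat (prime_below Q) * of_nat (num_primes_over (prime_below Q) L))"
    by (simp add: add_divide_distrib)
qed simp

text \<open>An integral \<open>w\<close> has nonnegative value at every prime of \<open>L\<close>,
  and a prime above \<open>P\<close> contributes a positive one.\<close>

lemma log_deriv_pos:
  assumes T: "finite T" "T \<subseteq> nonzero_primes K" and P: "P \<in> T" and w: "w \<in> P" "w \<noteq> 0"
  shows "0 < log_deriv T w"
proof -
  have PK: "P \<in> nonzero_primes K" using T P by blast
  interpret P: num_field_prime K P by (rule K.num_field_primeI[OF PK])
  obtain R where R: "R \<in> nonzero_primes L" "to_ac ` P \<subseteq> R"
    using ex_prime_above[OF PK] .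
  have RT: "R \<in> primes_above K T L"
    using R P contraction_eq[OF PK R] by (simp add: primes_above_def K.carrier_ring_of_integers)
  have wO: "to_ac w \<in> L.OK" using w P.P_closed(1) to_ac_OK by blast
  show ?thesis
    unfolding log_deriv_def
  proof (rule sum_pos2[OF finite_primes_above[OF T] RT])
    interpret R: num_field_prime L R by (rule L.num_field_primeI[OF R(1)])
    have "0 < R.val (to_ac w)" using R w by (intro R.val_pos) auto
    moreover have "prime_below R > 0" using R.prime_q R.q_def prime_gt_0_nat by simp
    \<comment> \<open>The count is a \<open>card\<close>, which would be 0 on an infinite set:
      finiteness of the set matters as well as the presence of \<open>R\<close> in it.\<close>
    moreover have "num_primes_over (prime_below R) L > 0"
      unfolding num_primes_over_def card_gt_0_iff
      using R(1) R.lies_over_q R.prime_q L.finite_primes_over R.q_def by auto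
    ultimately show "0 < R.val (to_ac w) / (of_nat (prime_below R) * of_nat (num_primes_over (prime_below R) L))"
      by simp
  next
    fix Q assume "Q \<in> primes_above K T L"
    then interpret Q: num_field_prime L Q
      using primes_above_prime by (intro L.num_field_primeI) auto
    show "0 \<le> Q.val (to_ac w) / (of_nat (prime_below Q) * of_nat (num_primes_over (prime_below Q) L))"
      using Q.val_nonneg[OF wO] w by simp
  qed
qed

text \<open>With \<open>w \<in> Q\<close> and \<open>w \<equiv> 1\<close> modulo \<open>P\<close> and the other primes of \<open>T\<close>, the elements
  \<open>u = 1 - (1 - w) (1 - w^2)^k = w (1 + w (1 - w) (1 + (1 - w^2) + \<dots> + (1 - w^2)^(k-1)))\<close> converge to 1
  at \<open>P\<close> and have the same valuations as \<open>w\<close> at all primes above \<open>T\<close>.\<close>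

lemma ex_near_one_const_log_deriv:
  assumes T: "finite T" "T \<subseteq> nonzero_primes K" and P: "P \<in> nonzero_primes K" and Q: "Q \<in> T" "Q \<noteq> P"
  obtains r where "0 < r"
    "\<forall>k. \<exists>u\<in>K.OK. u \<notin> P \<and> u - 1 \<in> num_field_prime.Pw K P k \<and> log_deriv T u = r"
proof -
  interpret P: num_field_prime K P by (rule K.num_field_primeI[OF P])
  have QK: "Q \<in> nonzero_primes K" using T Q by blast
  interpret Q: num_field_prime K Q by (rule K.num_field_primeI[OF QK])
  \<comment> \<open>\<open>P\<close> joins also when it is not in \<open>T\<close>, since
    convergence at \<open>P\<close> needs \<open>w\<close> congruent to 1 there.\<close>
  define S where "S = insert P T - {Q}"
  have S: "finite S" "S \<subseteq> nonzero_primes K" "Q \<notin> S" using T P by (auto simp: S_def)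
  obtain w where w: "w \<in> Q" "\<forall>R\<in>S. 1 - w \<in> R"
    using K.separate_prime[OF S(1,2) QK S(3)] .
  have PS: "P \<in> S" using Q by (auto simp: S_def)
  have wO: "w \<in> K.OK" using w Q.P_closed(1) by blast
  have one_diff_notin: "x \<notin> R" if R: "R \<in> S" and x: "1 - x \<in> R" for x R
  proof -
    interpret R: num_field_prime K R using S R by (intro K.num_field_primeI) auto
    show ?thesis using R.P_closed(3)[OF x, of x] R.one_notin_P by auto
  qed
  have wS: "w \<notin> R" if "R \<in> S" for R using one_diff_notin[OF that] w(2) that by blast
  have w0: "w \<noteq> 0" using wS[OF PS] P.P_closed(2) by auto
  show ?thesis
  proof (rule that)
    show "0 < log_deriv T w" by (rule log_deriv_pos[OF T Q(1) w(1) w0])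
    show "\<forall>k. \<exists>u\<in>K.OK. u \<notin> P \<and> u - 1 \<in> P.Pw k \<and> log_deriv T u = log_deriv T w"
    proof
      fix k
      \<comment> \<open>With \<open>1 - w\<close> in place of \<open>1 - w^2\<close>, the cofactor
        of \<open>w\<close> in \<open>u\<close> would be \<open>k + 1\<close> modulo
        \<open>Q\<close>, which may be 0. The square makes the cofactor \<open>t\<close> congruent
        to 1 modulo \<open>Q\<close> for every \<open>k\<close>.\<close>
      define z where "z = 1 - w ^ 2"
      define u where "u = 1 - (1 - w) * z ^ k"
      define s where "s = (\<Sum>i<k. z ^ i)"
      define t where "t = 1 + s * (1 - w) * w"
      have wO': "1 - w \<in> K.OK" "1 + w \<in> K.OK"
        using K.OK_closed(5)[OF K.OK_closed(2) wO] K.OK_closed(4)[OF K.OK_closed(2) wO] .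
      have zO: "z \<in> K.OK" unfolding z_def using wO by (intro K.OK_closed)
      have zkO: "z ^ k \<in> K.OK" using zO by (rule K.OK_closed(7))
      have uO: "u \<in> K.OK"
        unfolding u_def using K.OK_closed(5)[OF K.OK_closed(2) K.OK_closed(6)[OF wO'(1) zkO]] .
      have sO: "s \<in> K.OK" unfolding s_def by (rule K.OK_closed(8)) (rule K.OK_closed(7)[OF zO])
      have swO: "s * (1 - w) \<in> K.OK" using sO wO'(1) by (rule K.OK_closed(6))
      have tO: "t \<in> K.OK"
        unfolding t_def using K.OK_closed(4)[OF K.OK_closed(2) K.OK_closed(6)[OF swO wO]] .
      have "1 - z ^ k = w ^ 2 * s"
        using one_diff_power_eq[of z k] unfolding s_def by (simp add: z_def)
      hence zk: "z ^ k = 1 - w ^ 2 * s" by (simp add: algebra_simps)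
      have u_eq: "u = w * t" unfolding u_def t_def zk by (simp add: algebra_simps power2_eq_square)
      have uR: "u \<notin> R" if R: "R \<in> S" for R
      proof (rule one_diff_notin[OF R])
        interpret R: num_field_prime K R using S R by (intro K.num_field_primeI) auto
        have "1 - w \<in> R" using w(2) R by blast
        from R.P_closed(5)[OF this zkO] show "1 - u \<in> R" by (simp add: u_def)
      qed
      have tQ: "t \<notin> Q"
      proof
        assume "t \<in> Q"
        moreover have "s * (1 - w) * w \<in> Q" using w(1) swO by (rule Q.P_closed(4))
        ultimately have "t - s * (1 - w) * w \<in> Q" by (rule Q.P_closed(7))
        thus False using Q.one_notin_P by (simp add: t_def)
      qed
      have t0: "t \<noteq> 0" using tQ Q.P_closed(2) by auto
      have "u - 1 \<in> P.Pw k"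
      proof -
        have "z = (1 - w) * (1 + w)" by (simp add: z_def algebra_simps power2_eq_square)
        moreover have "1 - w \<in> P" using w(2) PS by blast
        ultimately have "z \<in> P" using P.P_closed(5) wO'(2) by simp
        hence "z ^ k \<in> P.Pw k" by (rule P.power_in_Pw)
        hence "(1 - w) * z ^ k \<in> P.Pw k" using wO'(1) by (rule P.Pw_closed(4))
        thus ?thesis using P.Pw_closed(6)[of "(1 - w) * z ^ k"] by (simp add: u_def)
      qed
      moreover have "log_deriv T u = log_deriv T w"
        unfolding log_deriv_def
      proof (rule sum.cong)
        fix R assume R: "R \<in> primes_above K T L"
        interpret R: num_field_prime L R
          using primes_above_prime[OF R] by (intro L.num_field_primeI)
        have notin: "to_ac x \<notin> R" if "x \<in> K.OK" "x \<notin> to_ac -` R \<inter> K.OK" for x using that by blast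
        \<comment> \<open>Above \<open>Q\<close> the cofactor \<open>t\<close> has value 0; above
          every other prime of \<open>T\<close> both \<open>u\<close> and \<open>w\<close> lie
          outside \<open>R\<close>, so both values are 0.\<close>
        have "R.val (to_ac u) = R.val (to_ac w)"
        proof (cases "to_ac -` R \<inter> K.OK = Q")
          case True
          hence "R.val (to_ac t) = 0" using tQ tO to_ac_OK by (intro R.val_eq_0 notin) auto
          moreover have "R.val (to_ac w * to_ac t) = R.val (to_ac w) + R.val (to_ac t)"
            using w0 t0 to_ac_OK[OF wO] to_ac_OK[OF tO] L.OK_subset by (intro R.val_mult) auto
          ultimately show ?thesis by (simp add: u_eq)
        next
          case False
          hence "to_ac -` R \<inter> K.OK \<in> S"
            using primes_above_prime(2)[OF R] by (simp add: S_def)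
          hence "R.val (to_ac u) = 0" "R.val (to_ac w) = 0"
            using uR wS uO wO by (auto intro!: R.val_eq_0 to_ac_OK notin)
          thus ?thesis by simp
        qed
        thus "R.val (to_ac u) / (of_nat (prime_below R) * of_nat (num_primes_over (prime_below R) L))
            = R.val (to_ac w) / (of_nat (prime_below R) * of_nat (num_primes_over (prime_below R) L))" by simp
      qed simp
      ultimately show "\<exists>u\<in>K.OK. u \<notin> P \<and> u - 1 \<in> P.Pw k \<and> log_deriv T u = log_deriv T w"
        using uO uR[OF PS] by blast
    qed
  qed
qed

end

text \<open>That \<open>D\<close> maps \<open>K\<close> into itself belongs to the claim:
  \<open>topcontinuous_at\<close> includes this condition, so its failure alone could otherwise
  account for discontinuity.\<close>

theorem theorem5p12:
  fixes K :: "'a::field_char_0 set" and P :: "'a set" and T :: "'a set set"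
    and n p :: nat and c :: real
  assumes "number_field K" and "has_degree K n"
    and "P \<in> nonzero_primes K" and "Factorial_Ring.prime p" and "lies_over_rational P p"
    and "T \<subseteq> nonzero_primes K" and "finite T" and "T \<noteq> {}" and "T \<noteq> {P}"
    and "0 < c" and "c < 1"
  shows "arith_subderiv K T \<in> K \<rightarrow> K \<and>
    (\<forall>x \<in> K - {0}. \<not> topcontinuous_at (padic_topology c K P) (padic_topology c K P)
                       (arith_subderiv K T) x)"
proof -
  interpret K: num_field K by unfold_locales fact
  define L where "L = galois_extension K"
  have L: "galois_over_rat L \<and> to_ac ` K \<subseteq> L"
    unfolding L_def galois_extension_def by (rule someI_ex[OF K.ex_galois_extension])
  interpret num_field_extension K L using L by unfold_locales (auto simp: galois_over_rat_def)
  interpret P: num_field_prime K P by (rule K.num_field_primeI) fact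
  interpret M: Metric_space K "\<lambda>x y. padic_abs c K P (x - y)"
    by (rule P.Metric_space_padic) fact+
  let ?D = "arith_subderiv K T" and ?l = "\<lambda>x. of_rat (log_deriv T x) :: 'a"
  have D: "?D x = x * ?l x" if "x \<noteq> 0" for x
    using galois_subderiv_to_ac[OF assms(7,6) that]
      by (simp add: arith_subderiv_def L_def[symmetric] del: to_ac_mult)
  have D0: "?D 0 = 0" by (simp add: arith_subderiv_def galois_subderiv_def)
  have "?D x \<in> K" if "x \<in> K" for x
    using that D[of x] D0 K.K_closed(1,6,13) by (cases "x = 0") auto
  moreover have "\<not> topcontinuous_at (padic_topology c K P) (padic_topology c K P) ?D x" if x: "x \<in> K - {0}" for x
  proof -
    obtain Q where Q: "Q \<in> T" "Q \<noteq> P" using assms(8,9) by blast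
    obtain r where r: "0 < r"
      "\<forall>k. \<exists>u\<in>K.OK. u \<notin> P \<and> u - 1 \<in> P.Pw k \<and> log_deriv T u = r"
      using ex_near_one_const_log_deriv[OF assms(7,6,3) Q] .
    let ?r = "of_rat r :: 'a"
    have rK: "?r \<in> K" "?r \<noteq> 0" "x * ?r \<in> K" using r(1) x K.K_closed(6,13) by auto
    have lK: "?l y \<in> K" for y by (rule K.K_closed(13))
    have one: "log_deriv T 1 = 0" using log_deriv_mult[of 1 1 T] K.K_closed(2) by simp
    \<comment> \<open>As \<open>ord u = 0\<close>, the terms \<open>x (u - 1) l x\<close> and
      \<open>x u r\<close> have orders \<open>ord x + ord (u - 1) + ord (l x)\<close> and
      \<open>ord x + ord r\<close>; from \<open>ord (u - 1) \<ge> k0\<close> on, the first is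
      strictly larger. For \<open>l x = 0\<close> the first term vanishes, which is treated
      apart.\<close>
    define k0 where "k0 = nat (P.ord ?r - P.ord (?l x) + 1)"
    have far: "padic_abs c K P (?D x - ?D (x * u)) = padic_abs c K P (x * ?r)"
      if k: "k0 \<le> k" and u: "u \<in> K.OK" "u \<notin> P" "u - 1 \<in> P.Pw k" "log_deriv T u = r" for k u
    proof -
      have u0: "u \<noteq> 0" using u(2) P.P_closed(2) by auto
      \<comment> \<open>The logarithmic derivative separates \<open>u\<close> from 1: it is
        \<open>r > 0\<close> at \<open>u\<close> and 0 at 1.\<close>
      have u1: "u - 1 \<noteq> 0" using u(4) one r(1) by auto
      have uK: "u \<in> K" using u(1) K.OK_subset by blast
      have u1O: "u - 1 \<in> K.OK" using u(3) P.Pw_closed(1) by blast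
      define A where "A = x * (u - 1) * ?l x"
      define B where "B = x * u * ?r"
      have B: "B \<in> K" "B \<noteq> 0" using x uK u0 rK K.K_closed(6) by (auto simp: B_def)
      have "P.ord u = 0" using P.ord_eq_0_iff u u0 by blast
      hence ordB: "P.ord B = P.ord (x * ?r)"
        unfolding B_def using x uK u0 rK K.K_closed(6) by (simp add: P.ord_mult)
      have AK: "A \<in> K"
        unfolding A_def using x u1O K.OK_subset lK K.K_closed(6) by (metis DiffD1 subsetD)
      have "?D (x * u) = x * u * (?l x + ?r)"
        using D[of "x * u"] x u0 uK u(4) log_deriv_mult[of x u T] by (simp add: of_rat_add)
      hence diff: "?D (x * u) - ?D x = A + B"
        using D[of x] x by (simp add: A_def B_def algebra_simps)
      have "A + B \<noteq> 0 \<and> P.ord (A + B) = P.ord B"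
      proof (cases "?l x = 0")
        case True
        thus ?thesis using B by (simp add: A_def)
      next
        case False
        have ordA: "P.ord A = P.ord x + P.ord (u - 1) + P.ord (?l x)"
          unfolding A_def
            using x u1O u1 K.OK_subset False lK K.K_closed(6) by (subst P.ord_mult, auto)+
        have "int k \<le> P.ord (u - 1)" using P.ord_ge_iff[OF u1O u1] u(3) by blast
        moreover have "P.ord (x * ?r) = P.ord x + P.ord ?r" using x rK by (simp add: P.ord_mult)
        ultimately have "P.ord B < P.ord A" using ordA ordB k unfolding k0_def by linarith
        moreover have "A \<noteq> 0" using x u1 False by (simp add: A_def)
        ultimately show ?thesis using P.ord_add_eq AK B by blast
      qed
      hence "padic_abs c K P (A + B) = padic_abs c K P (x * ?r)"
        using ordB x rK(2) by (simp add: padic_abs_def P.val_eq)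
      moreover have "?D x - ?D (x * u) = - (A + B)" using diff by (simp add: algebra_simps)
      ultimately show ?thesis using P.padic_abs_minus[OF assms(10,11), of "A + B"] by simp
    qed
    have "\<not> topcontinuous_at M.mtopology M.mtopology ?D x"
    proof (rule M.not_topcontinuous_at)
      show "0 < padic_abs c K P (x * ?r)" using x rK(2) assms(10) by (simp add: padic_abs_def)
      fix d :: real assume "d > 0"
      then obtain N
        where N: "\<And>k v. N \<le> k \<Longrightarrow> v \<in> P.Pw k \<Longrightarrow> padic_abs c K P (x * v) < d"
        using P.ex_small_padic_abs[OF assms(10,11)] x by blast
      \<comment> \<open>\<open>N\<close> brings \<open>x u\<close> within \<open>d\<close> of
        \<open>x\<close>, and \<open>k0\<close> fixes the distance between the two
        derivatives.\<close>
      obtain u where u: "u \<in> K.OK" "u \<notin> P" "u - 1 \<in> P.Pw (max N k0)" "log_deriv T u = r" using r(2) by blast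
      show "\<exists>y\<in>K. padic_abs c K P (x - y) < d \<and> padic_abs c K P (x * ?r) \<le> padic_abs c K P (?D x - ?D y)"
      proof (intro bexI conjI)
        show "x * u \<in> K" using x u(1) K.OK_subset K.K_closed(6) by blast
        have "x - x * u = - (x * (u - 1))" by (simp add: algebra_simps)
        thus "padic_abs c K P (x - x * u) < d"
          using N[OF _ u(3)] P.padic_abs_minus[OF assms(10,11)] by simp
        show "padic_abs c K P (x * ?r) \<le> padic_abs c K P (?D x - ?D (x * u))"
          using far[OF _ u] by simp
      qed
    qed (use x in auto)
    thus ?thesis by (simp add: padic_topology_def)
  qed
  ultimately show ?thesis by blast
qed

end
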